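(* Let $k\in\{0,1\}$ and $\pm=(-1)^k$. (1) For each fixed $s\in\mathbb C\setminus\mathbb Z$, the renormalized function $(a,c)\mapsto L^{R,\pm}(s,a,c)$ on $(0,1)\times(0,1)$ extends continuously to the closed unit square $\Box=[0,1]^2$. (2) For each fixed $(a,c)\in\Box$, the (extended) function $s\mapsto L^{R,\pm}(s,a,c)$ is a meromorphic function of $s\in\mathbb C$ having at most simple poles, with all poles in $\mathbb Z$. (3) For all $s\in\mathbb C\setminus\mathbb Z$ and $(a,c)\in\Box$, the completed renormalized functions $\hat L^{R,\pm}(s,a,c):=\pi^{-\frac{s+k}{2}}\Gamma\big(\frac{s+k}{2}\big)L^{R,\pm}(s,a,c)$ satisfy $$\hat L^{R,\pm}(s,a,c)=w_{\pm}e^{-2\pi i ac}\hat L^{R,\pm}(1-s,1-c,a),\qquad w_+=1,\ w_-=i.$$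
   Context: For $0<a,c<1$ let $L^{\pm}(s,a,c)=\zeta(s,a,c)\pm e^{-2\pi i a}\zeta(s,1-a,1-c)$, where $\zeta(s,a,c)=\sum_{n\ge0}e^{2\pi i n a}(n+c)^{-s}$ for $\Re(s)>1$; for $\Re(s)>1$, $L^+(s,a,c)=\sum_{n\in\mathbb Z}e^{2\pi ina}|n+c|^{-s}$ and $L^-(s,a,c)=\sum_{n\in\mathbb Z}\mathrm{sgn}(n+c)e^{2\pi ina}|n+c|^{-s}$, and $L^\pm(s,a,c)$ extends to an entire function of $s$. The Tate gamma functions are $$\gamma^{+}(s)=\frac{\pi^{-s/2}\Gamma(\frac s2)}{\pi^{-\frac{1-s}{2}}\Gamma(\frac{1-s}{2})},\qquad \gamma^{-}(s)=\frac{\pi^{-\frac{s+1}{2}}\Gamma(\frac{s+1}{2})}{\pi^{-\frac{2-s}{2}}\Gamma(\frac{2-s}{2})}.$$ For $s\in\mathbb C\setminus\mathbb Z$ and $0<a,c<1$, define $$S^{\pm}(s,a,c):=\big\{c^{-s}+(-1)^k e^{-2\pi i a}(1-c)^{-s}\big\}+i^k\gamma^{\pm}(1-s)\big\{e^{-2\pi i ac}a^{s-1}+(-1)^k e^{2\pi i(1-a)c}(1-a)^{s-1}\big\}$$ and the renormalized Lerch functions $L^{R,\pm}(s,a,c):=L^{\pm}(s,a,c)-S^{\pm}(s,a,c)$. On the boundary of $\Box$, $L^{R,\pm}(s,a,c)$ denotes the continuous extension from part (1). *)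

theory Defs
  imports "HOL-Complex_Analysis.Complex_Analysis"
begin

text \<open>
  The sign \<open>\<plusminus>\<close> is encoded by \<open>k \<in> {0, 1}\<close> with \<open>\<plusminus> = (-1)^k\<close>. The exponential \<open>e^{2 \<pi> i x}\<close> with
  \<open>x\<close> real is written \<open>cis (2 * pi * x)\<close>, and powers of positive reals with complex exponent
  use the principal branch of \<open>powr\<close>.
\<close>

text \<open>The Dirichlet series; it is used only for \<open>Re s > 1\<close>, where it converges absolutely.\<close>

definition lerch_zeta_series :: "complex \<Rightarrow> real \<Rightarrow> real \<Rightarrow> complex" where
  "lerch_zeta_series s a c =
     (\<Sum>n. cis (2 * pi * real n * a) * complex_of_real (real n + c) powr (-s))"

text \<open>
  The function \<open>L^\<plusminus>(s, a, c)\<close> for \<open>0 < a, c < 1\<close>, as the entire continuation from \<open>Re s > 1\<close>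
  (unique by the identity theorem).
\<close>

definition lerch_L :: "nat \<Rightarrow> complex \<Rightarrow> real \<Rightarrow> real \<Rightarrow> complex" where
  "lerch_L k s a c =
     (THE f. f holomorphic_on UNIV \<and>
        (\<forall>z. Re z > 1 \<longrightarrow>
           f z = lerch_zeta_series z a c
                 + (-1) ^ k * cis (- 2 * pi * a) * lerch_zeta_series z (1 - a) (1 - c))) s"

definition tate_gamma_plus :: "complex \<Rightarrow> complex" where
  "tate_gamma_plus s =
     (complex_of_real pi powr (- s / 2) * Gamma (s / 2)) /
     (complex_of_real pi powr (- (1 - s) / 2) * Gamma ((1 - s) / 2))"

definition tate_gamma_minus :: "complex \<Rightarrow> complex" where
  "tate_gamma_minus s =
     (complex_of_real pi powr (- (s + 1) / 2) * Gamma ((s + 1) / 2)) /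
     (complex_of_real pi powr (- (2 - s) / 2) * Gamma ((2 - s) / 2))"

definition tate_gamma :: "nat \<Rightarrow> complex \<Rightarrow> complex" where
  "tate_gamma k = (if k = 0 then tate_gamma_plus else tate_gamma_minus)"

definition lerch_S :: "nat \<Rightarrow> complex \<Rightarrow> real \<Rightarrow> real \<Rightarrow> complex" where
  "lerch_S k s a c =
     (complex_of_real c powr (-s)
        + (-1) ^ k * cis (- 2 * pi * a) * complex_of_real (1 - c) powr (-s))
     + \<i> ^ k * tate_gamma k (1 - s) *
       (cis (- 2 * pi * a * c) * complex_of_real a powr (s - 1)
        + (-1) ^ k * cis (2 * pi * (1 - a) * c) * complex_of_real (1 - a) powr (s - 1))"

definition lerch_LR_interior :: "nat \<Rightarrow> complex \<Rightarrow> real \<times> real \<Rightarrow> complex" where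
  "lerch_LR_interior k s = (\<lambda>(a, c). lerch_L k s a c - lerch_S k s a c)"

definition open_square :: "(real \<times> real) set" where
  "open_square = {0<..<1} \<times> {0<..<1}"

definition closed_square :: "(real \<times> real) set" where
  "closed_square = {0..1} \<times> {0..1}"

definition is_continuous_extension ::
  "(real \<times> real \<Rightarrow> complex) \<Rightarrow> (real \<times> real \<Rightarrow> complex) \<Rightarrow> bool" where
  "is_continuous_extension f g \<longleftrightarrow>
     continuous_on closed_square g \<and> (\<forall>p\<in>open_square. g p = f p)"

text \<open>
  The renormalized function on the closed square. Continuous extensions agree on the closed
  square, since the open square is dense in it, so there the choice operator picks a
  well-determined value whenever an extension exists. Values at integers \<open>s\<close> carry no meaning.
\<close>

definition lerch_LR :: "nat \<Rightarrow> complex \<Rightarrow> real \<Rightarrow> real \<Rightarrow> complex" where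
  "lerch_LR k s a c = (SOME g. is_continuous_extension (lerch_LR_interior k s) g) (a, c)"

definition completed_lerch_LR :: "nat \<Rightarrow> complex \<Rightarrow> real \<Rightarrow> real \<Rightarrow> complex" where
  "completed_lerch_LR k s a c =
     complex_of_real pi powr (- (s + of_nat k) / 2) * Gamma ((s + of_nat k) / 2) * lerch_LR k s a c"

definition root_number :: "nat \<Rightarrow> complex" where
  "root_number k = (if k = 0 then 1 else \<i>)"

end

theory Submission
  imports Defs "HOL-Probability.Characteristic_Functions"
begin

text \<open>
  Let \<open>\<theta>(t) = \<Sum>n. (n + c)\<^sup>k e^{2 \<pi> i n a} e^{-\<pi> (n + c)\<^sup>2 t}\<close> and \<open>z = (s + k) / 2\<close>. Poisson summation gives the
  transformation law of \<open>\<theta>\<close> under \<open>t \<mapsto> 1 / t\<close>, and Riemann's method then writes \<open>\<pi>^{-z} \<Gamma>(z) L\<close> as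
  a Mellin integral of \<open>\<theta>\<close> over \<open>t \<ge> 1\<close> plus its mirror image under \<open>(s, a, c) \<mapsto> (1 - s, 1 - c, a)\<close>.
  The only summands of \<open>\<theta>\<close> whose integral is not continuous up to the boundary of the square are
  \<open>n = 0, -1\<close>, where the integral is the upper incomplete gamma function. Subtracting \<open>S\<close> replaces
  it by minus the lower incomplete gamma function \<open>\<Sum>j. (-v)^j / (j! (z + j))\<close> with \<open>v = \<pi> (n + c)\<^sup>2\<close>, which is
  continuous at \<open>v = 0\<close> and has only simple poles in \<open>z\<close>. The resulting formula is
  manifestly continuous on the closed square, meromorphic in \<open>s\<close>, and symmetric.
\<close>

section \<open>Fourier uniqueness and Poisson summation\<close>

text \<open>Multiplied by the completing factor, \<open>lerch_S\<close> is exactly the pair of edge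
  terms with Gamma(z) v^(-z), the integral over all t > 0, in place of its part over t >= 1: the
  first brace for (a, c) and z, the second for (1 - c, a) and (1 - s + k) / 2. Hence one subtraction
  repairs all four sides of the square, since c = 0, 1 are singular for the first integral and a =
  0, 1 for its mirror image. Every other index satisfies |n + c| >= 1 on the closed square, so one
  decay rate e^(-pi t) serves everywhere. The mirror map (a, c) -> (1 - c, a) has order four, not
  two. Symmetry of the formula therefore also needs the reflection (a, c) -> (1 - a, 1 - c), whose
  sign (-1)^k cancels against i^k i^k. Poisson summation rests on uniqueness of Fourier coefficients
  of continuous functions, so no pointwise convergence theorem for Fourier series enters. Because
  \<open>lerch_LR\<close> has no meaning at integer s, poles are examined through formulas valid on
  punctured neighbourhoods only.\<close>

lemma continuous_circle_lift:
  fixes D :: "real \<Rightarrow> complex"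
  assumes "continuous_on {0..1} D" "D 0 = D 1"
  obtains \<phi> where "continuous_on (sphere 0 1) \<phi>" "\<And>c. c \<in> {0..1} \<Longrightarrow> \<phi> (cis (2 * pi * c)) = D c"
proof
  let ?\<phi> = "D \<circ> (\<lambda>z. Arg2pi z / (2 * pi))"
  \<comment> \<open>The constant homotopy from \<open>D\<close> to itself serves only to extract
    continuity of the induced circle map; the jump of \<open>Arg2pi\<close> at 1 then needs no
    separate treatment.\<close>
  have "homotopic_loops UNIV D D"
    using assms by (simp add: homotopic_loops_refl path_def pathfinish_def pathstart_def)
  from homotopic_with_imp_continuous[OF homotopic_loops_imp_homotopic_circlemaps[OF this]]
  show "continuous_on (sphere 0 1) ?\<phi>" by simp
  show "?\<phi> (cis (2 * pi * c)) = D c" if "c \<in> {0..1}" for c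
  proof (cases "c = 1")
    case True
    then show ?thesis using assms by (simp add: cis_2pi Arg2pi_of_real[of 1, simplified])
  next
    case False
    with that have "Arg2pi (cis (2 * pi * c)) = 2 * pi * c"
      by (intro Arg2pi_unique[of 1]) (auto simp: cis_conv_exp mult_ac)
    then show ?thesis by simp
  qed
qed

text \<open>On the unit circle a real-linear functional is a combination of \<open>cis t\<close> and
  \<open>cis (- t)\<close>, so multiplying by it shifts all frequencies by 1 and -1. Products work
  because \<open>h\<close> is arbitrary in the induction: the factors are absorbed into
  \<open>h\<close> one after the other.\<close>

lemma vanishing_fourier_coeffs_mult_poly:
  fixes p :: "complex \<Rightarrow> real"
  assumes "real_polynomial_function p"
    and "continuous_on {0..1} h"
    and "\<And>m::int. integral {0..1} (\<lambda>c. h c * cis (2 * pi * of_int m * c)) = 0"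
  shows "continuous_on {0..1} (\<lambda>c. h c * of_real (p (cis (2 * pi * c)))) \<and>
    (\<forall>m::int. integral {0..1} (\<lambda>c. h c * of_real (p (cis (2 * pi * c))) * cis (2 * pi * of_int m * c)) = 0)"
  using assms
proof (induction arbitrary: h rule: real_polynomial_function.induct)
  case (linear p)
  define \<alpha> where "\<alpha> = (of_real (p 1) - \<i> * of_real (p \<i>)) / 2"
  define \<beta> where "\<beta> = (of_real (p 1) + \<i> * of_real (p \<i>)) / 2"
  have p: "of_real (p (cis t)) = \<alpha> * cis t + \<beta> * cis (-t)" for t
  proof -
    have "cis t = cos t *\<^sub>R 1 + sin t *\<^sub>R \<i>" by (simp add: complex_eq_iff)
    also have "p \<dots> = cos t * p 1 + sin t * p \<i>"
      using linear.hyps by (simp add: linear_simps(1) linear_simps(5))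
    finally show ?thesis
      by (simp add: \<alpha>_def \<beta>_def complex_eq_iff field_simps)
  qed
  have c: "continuous_on {0..1} (\<lambda>c. h c * cis (2 * pi * of_int m * c))" for m::int
    using linear.prems(1) by (intro continuous_intros)
  have eq: "h c * of_real (p (cis (2 * pi * c))) * cis (2 * pi * of_int m * c) =
      \<alpha> * (h c * cis (2 * pi * of_int (m + 1) * c)) + \<beta> * (h c * cis (2 * pi * of_int (m - 1) * c))"
    for m c
  proof -
    have "cis (2 * pi * of_int (m + 1) * c) = cis (2 * pi * c) * cis (2 * pi * of_int m * c)"
      "cis (2 * pi * of_int (m - 1) * c) = cis (- (2 * pi * c)) * cis (2 * pi * of_int m * c)"
      unfolding cis_mult by (simp_all add: algebra_simps)
    then show ?thesis by (simp add: p algebra_simps)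
  qed
  have "continuous_on {0..1} (\<lambda>c. h c * of_real (p (cis (2 * pi * c))))"
    unfolding p by (intro continuous_intros linear.prems)
  moreover have "integral {0..1} (\<lambda>c. h c * of_real (p (cis (2 * pi * c))) * cis (2 * pi * of_int m * c)) = 0" for m :: int
  proof -
    have "((\<lambda>c. \<alpha> * (h c * cis (2 * pi * of_int (m + 1) * c)) + \<beta> * (h c * cis (2 * pi * of_int (m - 1) * c)))
       has_integral (\<alpha> * 0 + \<beta> * 0)) {0..1}"
      by (intro has_integral_add has_integral_mult_right)
        (metis linear.prems(2) c integrable_integral integrable_continuous_real)+
    then show ?thesis unfolding eq by (simp add: integral_unique)
  qed
  ultimately show ?case by blast
next
  case (const k)
  have "integral {0..1} (\<lambda>c. h c * of_real k * cis (2 * pi * of_int m * c)) = 0" for m :: int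
  proof -
    have "(\<lambda>c. h c * of_real k * cis (2 * pi * of_int m * c)) = (\<lambda>c. of_real k * (h c * cis (2 * pi * of_int m * c)))"
      by (simp add: mult_ac)
    then show ?thesis using const(2)[of m] by simp
  qed
  then show ?case by (intro conjI allI continuous_intros const) auto
next
  case (add p q)
  note IP = add.IH(1)[OF add.prems] and IQ = add.IH(2)[OF add.prems]
  have c: "continuous_on {0..1} (\<lambda>c. h c * of_real (p (cis (2 * pi * c))) * cis (2 * pi * of_int m * c))"
    "continuous_on {0..1} (\<lambda>c. h c * of_real (q (cis (2 * pi * c))) * cis (2 * pi * of_int m * c))" for m :: int
    by (rule continuous_on_mult[OF conjunct1[OF IP]] continuous_on_mult[OF conjunct1[OF IQ]]; intro continuous_intros)+
  show ?case
  proof (intro conjI allI)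
    show "continuous_on {0..1} (\<lambda>c. h c * of_real (p (cis (2 * pi * c)) + q (cis (2 * pi * c))))"
      using continuous_on_add[OF conjunct1[OF IP] conjunct1[OF IQ]] by (simp add: ring_distribs)
    show "integral {0..1} (\<lambda>c. h c * of_real (p (cis (2 * pi * c)) + q (cis (2 * pi * c))) * cis (2 * pi * of_int m * c)) = 0" for m :: int
      using IP IQ c by (simp add: ring_distribs integral_add integrable_continuous_real)
  qed
next
  case (mult p q)
  note IP = mult.IH(1)[OF mult.prems]
  show ?case using mult.IH(2)[OF conjunct1[OF IP]] IP by (simp add: mult_ac)
qed

text \<open>By Stone-Weierstrass \<open>D\<close> is uniformly close to p + i q for trigonometric
  polynomials p, q. Since \<open>D\<close> times p - i q has integral 0, the integral of |D|^2
  equals that of D (cnj D - (p - i q)) and is arbitrarily small.\<close>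

lemma vanishing_fourier_coeffs_imp_zero:
  fixes D :: "real \<Rightarrow> complex"
  assumes D: "continuous_on {0..1} D" "D 0 = D 1"
    and coeffs: "\<And>m::int. integral {0..1} (\<lambda>c. D c * cis (2 * pi * of_int m * c)) = 0"
    and c: "c \<in> {0..1}"
  shows "D c = 0"
proof -
  obtain \<phi> where \<phi>: "continuous_on (sphere 0 1) \<phi>" "\<And>c. c \<in> {0..1} \<Longrightarrow> \<phi> (cis (2 * pi * c)) = D c"
    using continuous_circle_lift[OF D] by blast
  have "bounded (D ` {0..1})"
    using D(1) compact_Icc compact_continuous_image compact_imp_bounded by blast
  then obtain B where B: "B > 0" "\<And>x. x \<in> {0..1} \<Longrightarrow> norm (D x) \<le> B"
    by (auto simp: bounded_pos)
  have cont2: "continuous_on {0..1} (\<lambda>x. (norm (D x))\<^sup>2)"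
    by (intro continuous_intros D)
  have intD: "(\<lambda>x. (norm (D x))\<^sup>2) integrable_on {0..1}"
    by (rule integrable_continuous_real[OF cont2])
  have small: "integral {0..1} (\<lambda>x. (norm (D x))\<^sup>2) \<le> e" if "e > 0" for e
  proof -
    \<comment> \<open>Real and imaginary part each contribute an error of at most d, so this choice
      makes B (d + d) = e.\<close>
    define d where "d = e / (2 * B)"
    have "d > 0" using that B by (simp add: d_def)
    have "continuous_on (sphere 0 1) (\<lambda>x. Re (\<phi> x))"
      by (intro continuous_intros \<phi>)
    then obtain p where p: "real_polynomial_function p" "\<And>x. x \<in> sphere 0 1 \<Longrightarrow> \<bar>Re (\<phi> x) - p x\<bar> < d"
      using Stone_Weierstrass_real_polynomial_function[OF compact_sphere _ \<open>d > 0\<close>] by blast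
    have "continuous_on (sphere 0 1) (\<lambda>x. Im (\<phi> x))"
      by (intro continuous_intros \<phi>)
    then obtain q where q: "real_polynomial_function q" "\<And>x. x \<in> sphere 0 1 \<Longrightarrow> \<bar>Im (\<phi> x) - q x\<bar> < d"
      using Stone_Weierstrass_real_polynomial_function[OF compact_sphere _ \<open>d > 0\<close>] by blast
    define P where "P x = D x * of_real (p (cis (2 * pi * x)))" for x
    define Q where "Q x = D x * of_real (q (cis (2 * pi * x)))" for x
    have P: "continuous_on {0..1} P" "integral {0..1} P = 0"
      using conjunct1[OF vanishing_fourier_coeffs_mult_poly[OF p(1) D(1) coeffs]]
        spec[OF conjunct2[OF vanishing_fourier_coeffs_mult_poly[OF p(1) D(1) coeffs]], of 0]
      by (simp_all add: P_def[abs_def])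
    have Q: "continuous_on {0..1} Q" "integral {0..1} Q = 0"
      using conjunct1[OF vanishing_fourier_coeffs_mult_poly[OF q(1) D(1) coeffs]]
        spec[OF conjunct2[OF vanishing_fourier_coeffs_mult_poly[OF q(1) D(1) coeffs]], of 0]
      by (simp_all add: Q_def[abs_def])
    define R where "R x = D x * cnj (D x) - (P x - \<i> * Q x)" for x
    have cR: "continuous_on {0..1} R"
      unfolding R_def by (intro continuous_intros D P Q)
    have R: "norm (R x) \<le> e" if x: "x \<in> {0..1}" for x
    proof -
      let ?w = "cis (2 * pi * x)"
      have "R x = D x * (of_real (Re (\<phi> ?w) - p ?w) - \<i> * of_real (Im (\<phi> ?w) - q ?w))"
        using \<phi>(2)[OF x] unfolding R_def P_def Q_def
        by (simp add: complex_eq_iff algebra_simps)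
      also have "norm \<dots> \<le> B * (d + d)"
        unfolding norm_mult
      proof (intro mult_mono B x)
        show "norm (of_real (Re (\<phi> ?w) - p ?w) - \<i> * of_real (Im (\<phi> ?w) - q ?w)) \<le> d + d"
          using p(2)[of ?w] q(2)[of ?w]
          by (intro order_trans[OF norm_triangle_ineq4] add_mono) (auto simp: norm_mult simp del: of_real_diff)
      qed (use B in auto)
      also have "\<dots> = e" using B by (simp add: d_def)
      finally show ?thesis .
    qed
    have "integral {0..1} R = integral {0..1} (\<lambda>x. D x * cnj (D x)) - (integral {0..1} P - \<i> * integral {0..1} Q)"
      unfolding R_def
      by (rule integral_unique, intro has_integral_diff has_integral_mult_right integrable_integral
            integrable_continuous_real continuous_intros D P Q)
    also have "\<dots> = integral {0..1} (\<lambda>x. of_real ((norm (D x))\<^sup>2))"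
      by (simp add: P Q complex_norm_square del: of_real_power)
    also have "\<dots> = of_real (integral {0..1} (\<lambda>x. (norm (D x))\<^sup>2))"
      using has_integral_of_real[OF integrable_integral[OF intD], where 'b = complex] by (rule integral_unique)
    finally have "norm (of_real (integral {0..1} (\<lambda>x. (norm (D x))\<^sup>2)) :: complex) \<le> e * (1 - 0)"
      using integral_bound[of 0 1 R e] cR R by simp
    then show ?thesis by simp
  qed
  have "integral {0..1} (\<lambda>x. (norm (D x))\<^sup>2) \<le> 0"
    by (rule field_le_epsilon) (simp add: small)
  moreover have "integral {0..1} (\<lambda>x. (norm (D x))\<^sup>2) \<ge> 0"
    by (intro integral_nonneg intD) auto
  ultimately have "integral {0..1} (\<lambda>x. (norm (D x))\<^sup>2) = 0"
    by simp
  then show ?thesis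
    using integral_eq_0_iff[OF cont2] c by auto
qed

lemma continuous_on_dominated_suminf:
  fixes u :: "nat \<Rightarrow> 'a::topological_space \<Rightarrow> complex"
  assumes "\<And>n. continuous_on S (u n)" "\<And>n x. x \<in> S \<Longrightarrow> norm (u n x) \<le> M n" "summable M"
  shows "continuous_on S (\<lambda>x. \<Sum>n. u n x)"
proof -
  have "uniform_limit S (\<lambda>N x. \<Sum>n<N. u n x) (\<lambda>x. \<Sum>n. u n x) sequentially"
    using assms by (intro Weierstrass_m_test)
  then show ?thesis
    using assms(1) by (intro uniform_limit_theorem[where F = sequentially])
      (auto intro!: always_eventually continuous_on_sum)
qed

lemma integral_dominated_suminf:
  fixes u :: "nat \<Rightarrow> real \<Rightarrow> complex"
  assumes "\<And>n. continuous_on {a..b} (u n)" "\<And>n x. x \<in> {a..b} \<Longrightarrow> norm (u n x) \<le> M n" "summable M"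
  shows "(\<lambda>n. integral {a..b} (u n)) sums integral {a..b} (\<lambda>x. \<Sum>n. u n x)"
proof -
  have "uniform_limit {a..b} (\<lambda>N x. \<Sum>n<N. u n x) (\<lambda>x. \<Sum>n. u n x) sequentially"
    using assms by (intro Weierstrass_m_test)
  then obtain I J where IJ: "\<And>N. ((\<lambda>x. \<Sum>n<N. u n x) has_integral I N) {a..b}"
      "((\<lambda>x. \<Sum>n. u n x) has_integral J) {a..b}" "I \<longlonglongrightarrow> J"
    using assms(1) by (elim uniform_limit_integral) (auto intro!: continuous_on_sum)
  have "I = (\<lambda>N. \<Sum>n<N. integral {a..b} (u n))"
    using integral_unique[OF IJ(1)] assms(1)
    by (intro ext) (simp add: integral_sum integrable_continuous_real)
  then show ?thesis
    using IJ(2,3) by (simp add: sums_def integral_unique)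
qed

lemma integral_cis_period:
  "integral {0..1} (\<lambda>x. cis (2 * pi * of_int j * x)) = (if j = 0 then 1 else 0)"
proof (cases "j = 0")
  case False
  let ?w = "2 * pi * of_int j :: real"
  have "((\<lambda>x. cis (?w * x)) has_integral (cis (?w * 1) / (\<i> * ?w) - cis (?w * 0) / (\<i> * ?w))) {0..1}"
  proof (rule fundamental_theorem_of_calculus)
    fix x :: real
    have "((\<lambda>z. exp (\<i> * of_real ?w * z) / (\<i> * ?w)) has_field_derivative exp (\<i> * of_real ?w * of_real x)) (at (of_real x))"
      using False by (auto intro!: derivative_eq_intros)
    from has_vector_derivative_real_field[OF this]
    show "((\<lambda>x. cis (?w * x) / (\<i> * ?w)) has_vector_derivative cis (?w * x)) (at x within {0..1})"
      by (simp add: cis_conv_exp mult_ac has_vector_derivative_at_within)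
  qed simp
  then show ?thesis using False by (simp add: cis_multiple_2pi integral_unique)
qed simp

text \<open>The periodization of \<open>g\<close> minus the Fourier series with coefficients
  \<open>gh\<close> is continuous, takes equal values at 0 and 1 and has vanishing Fourier
  coefficients. The Fourier transform is required only as a limit over [-N, N], because the N-th
  partial sum of the paired periodization unfolds to precisely that interval; conditional
  convergence is enough.\<close>

lemma poisson_summation:
  fixes g :: "real \<Rightarrow> complex" and gh :: "int \<Rightarrow> complex"
  assumes cont: "continuous_on UNIV g"
    and M: "summable M" "\<And>n x. x \<in> {0..1} \<Longrightarrow> norm (g (real n + x)) \<le> M n"
      "\<And>n x. x \<in> {0..1} \<Longrightarrow> norm (g (x - 1 - real n)) \<le> M n"
    and H: "summable (\<lambda>n. norm (gh (int n)))" "summable (\<lambda>n. norm (gh (-1 - int n)))"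
    and FT: "\<And>m::int. (\<lambda>N::nat. integral {-real N..real N} (\<lambda>x. g x * cis (- 2 * pi * of_int m * x)))
               \<longlonglongrightarrow> gh m"
    and x: "x \<in> {0..1}"
  shows "(\<Sum>n. g (real n + x) + g (x - 1 - real n)) =
    (\<Sum>n. gh (int n) * cis (2 * pi * of_int (int n) * x) +
          gh (-1 - int n) * cis (2 * pi * of_int (-1 - int n) * x))"
proof -
  define u where "u n x = g (real n + x) + g (x - 1 - real n)" for n x
  define v where "v n x = gh (int n) * cis (2 * pi * of_int (int n) * x) +
          gh (-1 - int n) * cis (2 * pi * of_int (-1 - int n) * x)" for n x
  define D where "D x = (\<Sum>n. u n x) - (\<Sum>n. v n x)" for x
  define K where "K n = norm (gh (int n)) + norm (gh (-1 - int n))" for n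
  have u: "continuous_on A (u n)" for n A
    unfolding u_def by (intro continuous_intros continuous_on_compose2[OF cont]) auto
  have uM: "norm (u n x) \<le> 2 * M n" if "x \<in> {0..1}" for n x
    unfolding u_def mult_2 by (intro norm_triangle_mono M that)
  have sM: "summable (\<lambda>n. 2 * M n)" by (intro summable_mult M)
  have v: "continuous_on A (v n)" for n A
    unfolding v_def by (intro continuous_intros)
  have vK: "norm (v n x) \<le> K n" for n x
    unfolding v_def K_def by (intro norm_triangle_mono) (auto simp: norm_mult)
  have sK: "summable K" unfolding K_def by (intro summable_add H)
  have cu: "continuous_on {0..1} (\<lambda>x. \<Sum>n. u n x)"
    by (rule continuous_on_dominated_suminf[OF u uM sM])
  have cv: "continuous_on {0..1} (\<lambda>x. \<Sum>n. v n x)"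
    by (rule continuous_on_dominated_suminf[OF v vK sK])
  have su: "summable (\<lambda>n. u n x)" if "x \<in> {0..1}" for x
    by (rule summable_comparison_test'[OF sM, of 0]) (use uM that in auto)
  have sv: "summable (\<lambda>n. v n x)" for x
    by (rule summable_comparison_test'[OF sK, of 0]) (use vK in auto)
  have D01: "D 0 = D 1"
  proof -
    \<comment> \<open>Pairing n with -1 - n destroys periodicity of the single summands, but the
      defect \<open>u n 1 - u n 0\<close> telescopes in \<open>w\<close>.\<close>
    define w where "w n = g (real n) - g (- real n)" for n
    have M0: "M \<longlonglongrightarrow> 0" using M(1) by (rule summable_LIMSEQ_zero)
    have "(\<lambda>n. g (real n)) \<longlonglongrightarrow> 0"
      by (rule tendsto_norm_zero_cancel, rule tendsto_sandwich[OF _ _ tendsto_const M0])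
        (use M(2)[of 0] in auto)
    moreover have "(\<lambda>n. g (- real n)) \<longlonglongrightarrow> 0"
      by (rule tendsto_norm_zero_cancel, rule tendsto_sandwich[OF _ _ tendsto_const M0])
        (use M(3)[of 1] in auto)
    ultimately have "w \<longlonglongrightarrow> 0 - 0" unfolding w_def by (intro tendsto_diff)
    from telescope_sums[OF this] have "(\<lambda>n. w (Suc n) - w n) sums 0" by (simp add: w_def)
    moreover have "w (Suc n) - w n = u n 1 - u n 0" for n
      by (simp add: w_def u_def algebra_simps)
    ultimately have "(\<lambda>n. u n 1 - u n 0) sums 0" by simp
    moreover have "(\<lambda>n. u n 1 - u n 0) sums ((\<Sum>n. u n 1) - (\<Sum>n. u n 0))"
      by (intro sums_diff summable_sums su) auto
    ultimately have "(\<Sum>n. u n 1) = (\<Sum>n. u n 0)"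
      using sums_unique2 by fastforce
    moreover have "v n 1 = v n 0" for n
    proof -
      have "cis (2 * pi * of_int j) = 1" for j by (rule cis_multiple_2pi) auto
      from this[of "int n"] this[of "-1 - int n"] show ?thesis by (simp only: v_def mult_1_right mult_zero_right cis_zero)
    qed
    ultimately show ?thesis by (simp add: D_def)
  qed
  have coeff: "integral {0..1} (\<lambda>x. D x * cis (2 * pi * of_int m * x)) = 0" for m :: int
  proof -
    define e where "e x = cis (2 * pi * of_int m * x)" for x
    have e: "continuous_on A e" for A unfolding e_def by (intro continuous_intros)
    have ne: "norm (e x) = 1" for x by (simp add: e_def)
    have per: "e (x + of_int j) = e x" for x j
    proof -
      have "e (x + of_int j) = cis (2 * pi * of_int m * x) * cis (2 * pi * of_int (m * j))"
        unfolding e_def cis_mult by (simp add: algebra_simps)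
      also have "cis (2 * pi * of_int (m * j)) = 1" by (rule cis_multiple_2pi) auto
      finally show ?thesis by (simp add: e_def)
    qed
    have ge: "continuous_on A (\<lambda>x. g x * e x)" for A
      using continuous_on_subset[OF cont] by (intro continuous_intros e) auto
    have shift: "integral {0..1} (\<lambda>x. g (x + of_int j) * e x) = integral {of_int j..of_int j + 1} (\<lambda>x. g x * e x)" for j
      using integral_shift[OF ge, of 0 1 "of_int j"] by (simp add: o_def per add.commute)
    \<comment> \<open>Unfolding: the n-th pair adds the intervals [n, n + 1] and [-1 - n, -n] on the
      two sides. The coefficient that appears is \<open>gh (-m)\<close>, since integration against
      \<open>e\<close> picks out frequency -m.\<close>
    have "(\<Sum>n<N. integral {0..1} (\<lambda>x. u n x * e x)) = integral {-real N..real N} (\<lambda>x. g x * e x)" for N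
    proof (induction N)
      case (Suc N)
      have "integral {0..1} (\<lambda>x. u N x * e x) =
        integral {0..1} (\<lambda>x. g (x + of_int (int N)) * e x) + integral {0..1} (\<lambda>x. g (x + of_int (-1 - int N)) * e x)"
        unfolding u_def ring_distribs
        by (subst integral_add)
           (auto intro!: integrable_continuous_real continuous_intros e continuous_on_compose2[OF cont] simp: algebra_simps)
      also have "\<dots> = integral {real N..real N + 1} (\<lambda>x. g x * e x) + integral {-1 - real N..- real N} (\<lambda>x. g x * e x)"
        unfolding shift by simp
      finally have 1: "integral {0..1} (\<lambda>x. u N x * e x) = \<dots>" .
      have i: "(\<lambda>x. g x * e x) integrable_on {p..q}" for p q
        by (rule integrable_continuous_real[OF ge])
      have "integral {-real (Suc N)..real (Suc N)} (\<lambda>x. g x * e x) =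
        integral {-1 - real N..- real N} (\<lambda>x. g x * e x) + (integral {-real N..real N} (\<lambda>x. g x * e x) +
           integral {real N..real N + 1} (\<lambda>x. g x * e x))"
        using Henstock_Kurzweil_Integration.integral_combine[OF _ _ i, of "-1 - real N" "- real N" "real N + 1"]
          Henstock_Kurzweil_Integration.integral_combine[OF _ _ i, of "- real N" "real N" "real N + 1"]
        by (simp add: algebra_simps)
      then show ?case using Suc 1 by simp
    qed simp
    moreover have "(\<lambda>N. integral {-real N..real N} (\<lambda>x. g x * e x)) \<longlonglongrightarrow> gh (-m)"
      using FT[of "-m"] by (simp add: e_def)
    ultimately have s1: "(\<lambda>n. integral {0..1} (\<lambda>x. u n x * e x)) sums gh (-m)"
      by (simp add: sums_def)
    have s2: "(\<lambda>n. integral {0..1} (\<lambda>x. u n x * e x)) sums integral {0..1} (\<lambda>x. \<Sum>n. u n x * e x)"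
      by (rule integral_dominated_suminf[OF _ _ sM])
        (use uM in \<open>auto intro!: continuous_intros u e simp: norm_mult ne\<close>)
    have U: "integral {0..1} (\<lambda>x. (\<Sum>n. u n x) * e x) = gh (-m)"
    proof -
      have "integral {0..1} (\<lambda>x. (\<Sum>n. u n x) * e x) = integral {0..1} (\<lambda>x. \<Sum>n. u n x * e x)"
        by (rule integral_cong) (simp add: suminf_mult2 su)
      then show ?thesis using sums_unique2[OF s1 s2] by simp
    qed
    have vint: "integral {0..1} (\<lambda>x. v n x * e x) =
       gh (int n) * (if int n = -m then 1 else 0) + gh (-1 - int n) * (if -1 - int n = -m then 1 else 0)" for n
    proof -
      have mult: "cis (2 * pi * of_int j * x) * e x = cis (2 * pi * of_int (j + m) * x)" for j x
        unfolding e_def cis_mult by (simp add: algebra_simps)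
      have "(\<lambda>x. v n x * e x) = (\<lambda>x. gh (int n) * cis (2 * pi * of_int (int n + m) * x) +
          gh (-1 - int n) * cis (2 * pi * of_int (-1 - int n + m) * x))"
        unfolding v_def mult[symmetric] by (simp add: algebra_simps)
      moreover have "((\<lambda>x. gh (int n) * cis (2 * pi * of_int (int n + m) * x) +
          gh (-1 - int n) * cis (2 * pi * of_int (-1 - int n + m) * x)) has_integral
         (gh (int n) * (if int n + m = 0 then 1 else 0) + gh (-1 - int n) * (if -1 - int n + m = 0 then 1 else 0))) {0..1}"
        unfolding integral_cis_period[symmetric]
        by (intro has_integral_add has_integral_mult_right integrable_integral integrable_continuous_real continuous_intros)
      moreover have "int n + m = 0 \<longleftrightarrow> int n = -m" "-1 - int n + m = 0 \<longleftrightarrow> -1 - int n = -m" by auto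
      ultimately show ?thesis by (simp only: integral_unique)
    qed
    \<comment> \<open>Exactly one integer in all the pairs equals -m: it is the first member of pair
      n = -m if m <= 0, and the second member of pair n = m - 1 otherwise.\<close>
    have s3: "(\<lambda>n. integral {0..1} (\<lambda>x. v n x * e x)) sums gh (-m)"
    proof (cases "-m \<ge> 0")
      case True
      have "integral {0..1} (\<lambda>x. v n x * e x) = (if n = nat (-m) then gh (int n) else 0)" for n
        using True unfolding vint by auto
      then show ?thesis using sums_single[of "nat (-m)" "\<lambda>n. gh (int n)"] True by simp
    next
      case False
      have "integral {0..1} (\<lambda>x. v n x * e x) = (if n = nat (m - 1) then gh (-1 - int n) else 0)" for n
        using False unfolding vint by auto
      then show ?thesis using sums_single[of "nat (m - 1)" "\<lambda>n. gh (-1 - int n)"] False by simp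
    qed
    have s4: "(\<lambda>n. integral {0..1} (\<lambda>x. v n x * e x)) sums integral {0..1} (\<lambda>x. \<Sum>n. v n x * e x)"
      by (rule integral_dominated_suminf[OF _ _ sK])
        (auto intro!: continuous_intros v e vK simp: norm_mult ne)
    have V: "integral {0..1} (\<lambda>x. (\<Sum>n. v n x) * e x) = gh (-m)"
      using sums_unique2[OF s3 s4] by (simp add: suminf_mult2 sv)
    have "integral {0..1} (\<lambda>x. D x * e x) =
        integral {0..1} (\<lambda>x. (\<Sum>n. u n x) * e x) - integral {0..1} (\<lambda>x. (\<Sum>n. v n x) * e x)"
      unfolding D_def left_diff_distrib
      by (intro integral_diff integrable_continuous_real continuous_intros cu cv e)
    then show ?thesis using U V by (simp add: e_def)
  qed
  have "D x = 0"
    by (rule vanishing_fourier_coeffs_imp_zero[OF _ D01 coeff x])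
      (unfold D_def, intro continuous_intros cu cv)
  then show ?thesis by (simp add: D_def u_def v_def)
qed

section \<open>The theta function and its transformation law\<close>

text \<open>The characteristic function of the standard normal distribution, rescaled by x -> b x.
  The factor b = sqrt (2 pi t) is the one that turns exp (- (b x)^2 / 2) into exp (- pi x^2
  t).\<close>

lemma gaussian_fourier_integral:
  fixes t y :: real
  assumes "t > 0"
  shows "integrable lborel (\<lambda>x. of_real (exp (- pi * x\<^sup>2 * t)) * cis (- 2 * pi * y * x))"
    "(LINT x|lborel. of_real (exp (- pi * x\<^sup>2 * t)) * cis (- 2 * pi * y * x)) =
       of_real (exp (- pi * y\<^sup>2 / t) / sqrt t)"
proof -
  define b where "b = sqrt (2 * pi * t)"
  have b: "b > 0" "b\<^sup>2 = 2 * pi * t" using assms by (auto simp: b_def)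
  define u where "u = - 2 * pi * y / b"
  let ?F = "\<lambda>x. std_normal_density x *\<^sub>R iexp (u * x)"
  have bo: "b = sqrt (2 * pi) * sqrt t" by (simp add: b_def real_sqrt_mult)
  have F: "?F (0 + b * x) = (1 / sqrt (2 * pi)) *\<^sub>R (of_real (exp (- pi * x\<^sup>2 * t)) * cis (- 2 * pi * y * x))" for x
  proof -
    have "std_normal_density (b * x) = exp (- pi * x\<^sup>2 * t) / sqrt (2 * pi)"
      using b by (simp add: normal_density_def power_mult_distrib field_simps)
    moreover have "u * (b * x) = - 2 * pi * y * x" using b(1) by (simp add: u_def)
    ultimately show ?thesis
      by (simp add: cis_conv_exp scaleR_conv_of_real mult_ac)
  qed
  have i: "integrable lborel ?F"
    by (rule Bochner_Integration.integrable_bound[OF integrable_normal_density[of 1 0]]) auto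
  then have "integrable lborel (\<lambda>x. ?F (0 + b * x))"
    using b(1) by (subst lborel_integrable_real_affine_iff) auto
  then have "integrable lborel (\<lambda>x. sqrt (2 * pi) *\<^sub>R ?F (0 + b * x))"
    by (rule integrable_scaleR_right)
  then show "integrable lborel (\<lambda>x. of_real (exp (- pi * x\<^sup>2 * t)) * cis (- 2 * pi * y * x))"
    unfolding F by simp
  have "of_real (exp (- (u\<^sup>2) / 2)) = (LINT x|lborel. ?F x)"
    using fun_cong[OF char_std_normal_distribution, of u] unfolding char_def
    by (subst (asm) integral_density) (auto simp: normal_density_nonneg)
  also have "\<dots> = b *\<^sub>R (LINT x|lborel. ?F (0 + b * x))"
    using lborel_integral_real_affine[of b ?F 0] b by simp
  also have "\<dots> = sqrt t *\<^sub>R (LINT x|lborel. of_real (exp (- pi * x\<^sup>2 * t)) * cis (- 2 * pi * y * x))"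
    unfolding F by (simp add: bo)
  finally have "(LINT x|lborel. of_real (exp (- pi * x\<^sup>2 * t)) * cis (- 2 * pi * y * x)) =
       of_real (exp (- (u\<^sup>2) / 2) / sqrt t)"
    using assms by (simp add: scaleR_conv_of_real field_simps)
  also have "- (u\<^sup>2) / 2 = - pi * y\<^sup>2 / t"
    using assms b by (simp add: u_def power_divide power_mult_distrib) (simp add: power2_eq_square)
  finally show "(LINT x|lborel. of_real (exp (- pi * x\<^sup>2 * t)) * cis (- 2 * pi * y * x)) =
       of_real (exp (- pi * y\<^sup>2 / t) / sqrt t)" .
qed

lemma integral_symmetric_interval_tendsto:
  fixes f :: "real \<Rightarrow> complex"
  assumes "integrable lborel f"
  shows "(\<lambda>N::nat. integral {-real N..real N} f) \<longlonglongrightarrow> (LINT x|lborel. f x)"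
proof -
  have "(\<lambda>N::nat. LINT x|lborel. indicator {-real N..real N} x *\<^sub>R f x) \<longlonglongrightarrow> (LINT x|lborel. f x)"
  proof (rule integral_dominated_convergence[where w = "\<lambda>x. norm (f x)"])
    show "AE x in lborel. (\<lambda>N. indicator {-real N..real N} x *\<^sub>R f x) \<longlonglongrightarrow> f x"
    proof (intro AE_I2 tendsto_eventually)
      fix x :: real
      have "eventually (\<lambda>N. real N \<ge> \<bar>x\<bar>) sequentially"
        using eventually_ge_at_top[of "nat \<lceil>\<bar>x\<bar>\<rceil>"] by eventually_elim linarith
      then show "eventually (\<lambda>N. indicator {-real N..real N} x *\<^sub>R f x = f x) sequentially"
        by eventually_elim (auto simp: indicator_def)
    qed
  qed (use assms in \<open>auto simp: indicator_def\<close>)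
  moreover have "(LINT x|lborel. indicator {-real N..real N} x *\<^sub>R f x) = integral {-real N..real N} f" for N
    using set_borel_integral_eq_integral(2)[of "{-real N..real N}" f] assms
    by (simp add: set_lebesgue_integral_def set_integrable_def integrable_mult_indicator)
  ultimately show ?thesis by simp
qed

text \<open>For k = 1 the derivative of \<open>h\<close> is a combination of \<open>x * h\<close>
  and \<open>h\<close>. Integrating it over [-N, N] expresses the first moment by the integral of
  \<open>h\<close> and boundary values that tend to 0.\<close>

lemma gaussian_moment_fourier_limit:
  fixes t y :: real
  assumes t: "t > 0" and k: "k \<in> {0, 1::nat}"
  shows "(\<lambda>N::nat. integral {-real N..real N} (\<lambda>x. of_real (x ^ k * exp (- pi * x\<^sup>2 * t)) * cis (- 2 * pi * y * x)))
    \<longlonglongrightarrow> (- \<i> * of_real (y / t)) ^ k * of_real (exp (- pi * y\<^sup>2 / t) / sqrt t)"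
proof -
  define h where "h x = of_real (exp (- pi * x\<^sup>2 * t)) * cis (- 2 * pi * y * x)" for x :: real
  define G where "G = complex_of_real (exp (- pi * y\<^sup>2 / t) / sqrt t)"
  have L0: "(\<lambda>N::nat. integral {-real N..real N} h) \<longlonglongrightarrow> G"
    using integral_symmetric_interval_tendsto[OF gaussian_fourier_integral(1)[OF t, of y]]
    unfolding gaussian_fourier_integral(2)[OF t] h_def G_def .
  have "k = 0 \<or> k = 1" using k by auto
  then show ?thesis
  proof
    assume "k = 0"
    then show ?thesis using L0 by (simp add: h_def[abs_def] G_def)
  next
    assume k1: "k = 1"
    have contx: "continuous_on A (\<lambda>x. of_real x * h x)" for A
      unfolding h_def by (intro continuous_intros)
    have conth: "continuous_on A h" for A
      unfolding h_def by (intro continuous_intros)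
    have der: "(h has_vector_derivative - 2 * pi * t * (of_real x * h x) - 2 * pi * \<i> * y * h x) (at x within A)" for x A
    proof -
      define H where "H z = exp (- of_real pi * z\<^sup>2 * of_real t) * exp (\<i> * (- 2 * of_real pi * of_real y * z))"
        for z :: complex
      have "(H has_field_derivative - 2 * pi * t * (of_real x * H (of_real x)) - 2 * pi * \<i> * y * H (of_real x))
          (at (of_real x))"
        unfolding H_def by (rule derivative_eq_intros refl)+ (simp add: algebra_simps)
      from has_vector_derivative_real_field[OF this]
      have "((\<lambda>x. H (of_real x)) has_vector_derivative
          - 2 * pi * t * (of_real x * H (of_real x)) - 2 * pi * \<i> * y * H (of_real x)) (at x within A)"
        by (simp add: has_vector_derivative_at_within)
      moreover have hx: "h x = H (of_real x)" for x
        by (simp add: h_def H_def cis_conv_exp exp_of_real[symmetric])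
      ultimately show ?thesis unfolding hx[abs_def] by blast
    qed
    have "integral {-real N..real N} (\<lambda>x. of_real x * h x) =
       - (h (real N) - h (- real N)) / (2 * pi * t) - \<i> * y / t * integral {-real N..real N} h" for N
    proof -
      have "((\<lambda>x. - 2 * pi * t * (of_real x * h x) - 2 * pi * \<i> * y * h x) has_integral (h (real N) - h (- real N)))
          {-real N..real N}"
        by (rule fundamental_theorem_of_calculus) (use der in auto)
      moreover have "((\<lambda>x. - 2 * pi * t * (of_real x * h x) - 2 * pi * \<i> * y * h x) has_integral
         (- 2 * pi * t * integral {-real N..real N} (\<lambda>x. of_real x * h x)
           - 2 * pi * \<i> * y * integral {-real N..real N} h)) {-real N..real N}"
        by (intro has_integral_diff has_integral_mult_right integrable_integral
            integrable_continuous_real contx conth)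
      ultimately have hd: "h (real N) - h (- real N) = - 2 * pi * t * integral {-real N..real N} (\<lambda>x. of_real x * h x)
           - 2 * pi * \<i> * y * integral {-real N..real N} h"
        by (rule has_integral_unique)
      show ?thesis unfolding hd using t by (simp add: field_simps)
    qed
    moreover have "(\<lambda>N::nat. - (h (real N) - h (- real N)) / (2 * pi * t) - \<i> * y / t * integral {-real N..real N} h)
        \<longlonglongrightarrow> - ((0 :: complex) - 0) / (2 * pi * t) - \<i> * y / t * G"
    proof -
      have z: "(\<lambda>N::nat. exp (- pi * (real N)\<^sup>2 * t)) \<longlonglongrightarrow> 0"
        using t by real_asymp
      have hz: "(\<lambda>N::nat. h (real N)) \<longlonglongrightarrow> 0" "(\<lambda>N::nat. h (- real N)) \<longlonglongrightarrow> 0"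
        by (rule tendsto_norm_zero_cancel, use z in \<open>simp add: h_def norm_mult\<close>)+
      show ?thesis by (intro tendsto_diff tendsto_divide tendsto_minus tendsto_mult tendsto_const L0 hz) (use t in auto)
    qed
    ultimately show ?thesis
      by (simp add: k1 h_def[abs_def] G_def mult_ac)
  qed
qed

text \<open>Since n <= n^2 <= x^2, the Gaussian is at most a geometric term; the factor n + 1 covers
  |x|^k for both k. The majorant is the differentiated geometric series.\<close>

lemma abs_power_mult_gaussian_le:
  fixes x t :: real
  assumes "real n \<le> \<bar>x\<bar>" "\<bar>x\<bar> \<le> real n + 1" "t \<ge> 0" "k \<in> {0, 1::nat}"
  shows "\<bar>x ^ k * exp (- pi * x\<^sup>2 * t)\<bar> \<le> real (Suc n) * exp (- pi * t) ^ n"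
proof -
  have "real n \<le> (real n)\<^sup>2" by (cases n) (auto simp: power2_eq_square)
  also have "\<dots> \<le> \<bar>x\<bar>\<^sup>2" using assms by (intro power_mono) auto
  finally have "real n * (pi * t) \<le> x\<^sup>2 * (pi * t)" using assms by (intro mult_right_mono) auto
  then have "exp (- pi * x\<^sup>2 * t) \<le> exp (- pi * t) ^ n"
    by (simp add: exp_of_nat_mult[symmetric] mult_ac)
  moreover have "\<bar>x ^ k\<bar> \<le> real (Suc n)" using assms by auto
  ultimately show ?thesis unfolding abs_mult by (intro mult_mono) auto
qed

lemma summable_Suc_mult_exp_power:
  assumes "t > 0"
  shows "summable (\<lambda>n. real (Suc n) * exp (- pi * t) ^ n)"
  using geometric_deriv_sums[of "exp (- pi * t)"] assms by (auto simp: sums_iff)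

definition theta_term :: "nat \<Rightarrow> real \<Rightarrow> real \<Rightarrow> int \<Rightarrow> real \<Rightarrow> complex" where
  "theta_term k a c n t =
     cis (2 * pi * of_int n * a) * of_real ((of_int n + c) ^ k * exp (- pi * (of_int n + c)\<^sup>2 * t))"

text \<open>
  The integers are summed in pairs \<open>{n, -1 - n}\<close>, so that the reflection \<open>n \<mapsto> -1 - n\<close>, which exchanges
  \<open>(a, c)\<close> and \<open>(1 - a, 1 - c)\<close>, preserves each summand.
\<close>

definition theta :: "nat \<Rightarrow> real \<Rightarrow> real \<Rightarrow> real \<Rightarrow> complex" where
  "theta k a c t = (\<Sum>n. theta_term k a c (int n) t + theta_term k a c (-1 - int n) t)"

lemma norm_theta_term_le:
  assumes "t \<ge> 0" "k \<in> {0, 1}" "c \<in> {0..1}"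
  shows "norm (theta_term k a c (int n) t) \<le> real (Suc n) * exp (- pi * t) ^ n"
    "norm (theta_term k a c (-1 - int n) t) \<le> real (Suc n) * exp (- pi * t) ^ n"
  using abs_power_mult_gaussian_le[of n "of_int (int n) + c" t k]
    abs_power_mult_gaussian_le[of n "of_int (-1 - int n) + c" t k] assms
  by (simp_all add: theta_term_def norm_mult del: of_real_mult)

lemma summable_theta:
  assumes "t > 0" "k \<in> {0, 1}" "c \<in> {0..1}"
  shows "summable (\<lambda>n. theta_term k a c (int n) t + theta_term k a c (-1 - int n) t)"
  by (intro summable_add; rule summable_comparison_test'[OF summable_Suc_mult_exp_power[OF assms(1)], of 0])
    (use norm_theta_term_le assms in auto)

text \<open>Poisson summation for a Gaussian times x^k, twisted by a character. The twist moves the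
  frequencies from m to m + a, so a becomes the shift of the dual series while the evaluation point
  becomes its character.\<close>

lemma theta_transformation:
  assumes t: "t > 0" and k: "k \<in> {0, 1}" and a: "a \<in> {0..1}" and c: "c \<in> {0..1}"
  shows "theta k a c t = \<i> ^ k * cis (- 2 * pi * a * c) * of_real (t powr (- 1 / 2 - real k)) * theta k (1 - c) a (1 / t)"
proof -
  define g where "g x = of_real (x ^ k * exp (- pi * x\<^sup>2 * t)) * cis (- 2 * pi * a * x)" for x :: real
  define gh where "gh m = (- \<i> * of_real ((of_int m + a) / t)) ^ k * of_real (exp (- pi * (of_int m + a)\<^sup>2 / t) / sqrt t)"
    for m :: int
  define C where "C = (1 / t) ^ k / sqrt t"
  have C: "C > 0" using t by (simp add: C_def)
  have gb: "norm (g x) \<le> real (Suc n) * exp (- pi * t) ^ n" if "real n \<le> \<bar>x\<bar>" "\<bar>x\<bar> \<le> real n + 1" for n x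
    using abs_power_mult_gaussian_le[OF that _ k, of t] t by (simp add: g_def norm_mult del: of_real_mult)
  have ghC: "norm (gh m) = C * \<bar>(of_int m + a) ^ k * exp (- pi * (of_int m + a)\<^sup>2 * (1 / t))\<bar>" for m
    using t by (simp add: gh_def C_def norm_mult norm_power norm_divide abs_mult power_divide power_abs del: of_real_add)
  have ghb: "norm (gh m) \<le> C * (real (Suc n) * exp (- pi * (1 / t)) ^ n)"
    if "real n \<le> \<bar>of_int m + a\<bar>" "\<bar>of_int m + a\<bar> \<le> real n + 1" for n m
    unfolding ghC using abs_power_mult_gaussian_le[OF that _ k, of "1 / t"] t C
    by (intro mult_left_mono) auto
  have ssum: "summable (\<lambda>n. C * (real (Suc n) * exp (- pi * (1 / t)) ^ n))"
    using t by (intro summable_mult summable_Suc_mult_exp_power) auto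
  \<comment> \<open>Evaluation at 1 - c makes the arguments of \<open>g\<close> run through -(m + c)
    for all integers m. There the twist gives cis (2 pi m a) with the right sign, and the dual
    series carries cis (2 pi m (1 - c)), which is the character of the point (1 - c, a).\<close>
  have P: "(\<Sum>n. g (real n + (1 - c)) + g ((1 - c) - 1 - real n)) =
    (\<Sum>n. gh (int n) * cis (2 * pi * of_int (int n) * (1 - c)) +
          gh (-1 - int n) * cis (2 * pi * of_int (-1 - int n) * (1 - c)))"
  proof (rule poisson_summation)
    show "continuous_on UNIV g" unfolding g_def by (intro continuous_intros)
    show "summable (\<lambda>n. real (Suc n) * exp (- pi * t) ^ n)"
      by (rule summable_Suc_mult_exp_power[OF t])
    show "norm (g (real n + x)) \<le> real (Suc n) * exp (- pi * t) ^ n" if "x \<in> {0..1}" for n x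
      using that by (intro gb) auto
    show "norm (g (x - 1 - real n)) \<le> real (Suc n) * exp (- pi * t) ^ n" if "x \<in> {0..1}" for n x
      using that by (intro gb) auto
    show "summable (\<lambda>n. norm (gh (int n)))"
      by (rule summable_comparison_test'[OF ssum, of 0]) (use ghb a in auto)
    show "summable (\<lambda>n. norm (gh (-1 - int n)))"
      by (rule summable_comparison_test'[OF ssum, of 0]) (use ghb a in auto)
    show "(\<lambda>N. integral {- real N..real N} (\<lambda>x. g x * cis (- 2 * pi * of_int m * x))) \<longlonglongrightarrow> gh m" for m
    proof -
      have "g x * cis (- 2 * pi * of_int m * x) =
         of_real (x ^ k * exp (- pi * x\<^sup>2 * t)) * cis (- 2 * pi * (of_int m + a) * x)" for x
        unfolding g_def mult.assoc cis_mult by (simp add: algebra_simps)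
      then show ?thesis using gaussian_moment_fourier_limit[OF t k, of "of_int m + a"]
        by (simp add: gh_def)
    qed
    show "1 - c \<in> {0..1}" using c by auto
  qed
  have L: "g (- (of_int m + c)) = (-1) ^ k * cis (2 * pi * a * c) * theta_term k a c m t" for m
  proof -
    have "g (- (of_int m + c)) = (-1) ^ k * of_real ((of_int m + c) ^ k * exp (- pi * (of_int m + c)\<^sup>2 * t)) *
        cis (2 * pi * a * c + 2 * pi * of_int m * a)"
      unfolding g_def by (subst power_minus) (simp add: algebra_simps power2_eq_square)
    then show ?thesis by (simp add: theta_term_def cis_mult[symmetric] mult_ac)
  qed
  have R: "gh m * cis (2 * pi * of_int m * (1 - c)) =
     (- \<i>) ^ k * of_real (t powr (- 1 / 2 - real k)) * theta_term k (1 - c) a m (1 / t)" for m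
  proof -
    have "t powr (- 1 / 2 - real k) = (1 / t) ^ k / sqrt t"
    proof -
      have "t powr (- 1 / 2 - real k) = inverse (t powr (1 / 2)) / t powr real k"
        unfolding powr_diff powr_minus[symmetric] by simp
      then show ?thesis using t by (simp add: powr_half_sqrt powr_realpow power_divide field_simps)
    qed
    moreover have "(- \<i> * of_real ((of_int m + a) / t)) ^ k = (- \<i>) ^ k * of_real ((1 / t) ^ k) * of_real ((of_int m + a) ^ k)"
      unfolding power_mult_distrib by (simp add: power_divide)
    ultimately show ?thesis
      by (simp add: gh_def theta_term_def)
  qed
  note S1 = summable_theta[OF t k c, of a] and S2 = summable_theta[OF _ k a, of "1 / t" "1 - c"]
  have "(\<Sum>n. g (real n + (1 - c)) + g ((1 - c) - 1 - real n)) = (-1) ^ k * cis (2 * pi * a * c) * theta k a c t"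
  proof -
    have "g (real n + (1 - c)) + g ((1 - c) - 1 - real n) =
      (-1) ^ k * cis (2 * pi * a * c) * (theta_term k a c (int n) t + theta_term k a c (-1 - int n) t)" for n
      using L[of "int n"] L[of "-1 - int n"] by (simp add: algebra_simps)
    then show ?thesis using S1 by (simp add: suminf_mult theta_def)
  qed
  moreover have "(\<Sum>n. gh (int n) * cis (2 * pi * of_int (int n) * (1 - c)) +
          gh (-1 - int n) * cis (2 * pi * of_int (-1 - int n) * (1 - c))) =
     (- \<i>) ^ k * of_real (t powr (- 1 / 2 - real k)) * theta k (1 - c) a (1 / t)"
    unfolding R using S2 t by (simp add: suminf_mult theta_def flip: distrib_left)
  ultimately have eq: "(-1) ^ k * cis (2 * pi * a * c) * theta k a c t =
     (- \<i>) ^ k * of_real (t powr (- 1 / 2 - real k)) * theta k (1 - c) a (1 / t)"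
    using P by simp
  \<comment> \<open>Inverts the prefactor (-1)^k cis (2 pi a c) of the left-hand side; afterwards
    (-1)^k (-i)^k = i^k.\<close>
  have ab: "T = (e * x) * (e * y * T)" if "x * y = 1" "e * e = 1" for T e x y :: complex
  proof -
    have "(e * x) * (e * y * T) = (x * y) * (e * e) * T" by (simp only: mult_ac)
    then show ?thesis using that by simp
  qed
  have "cis (- 2 * pi * a * c) * cis (2 * pi * a * c) = 1"
    unfolding cis_mult by simp
  moreover have "(-1 :: complex) ^ k * (-1) ^ k = 1"
    unfolding power_mult_distrib[symmetric] by simp
  ultimately have "theta k a c t = ((-1) ^ k * cis (- 2 * pi * a * c)) * ((-1) ^ k * cis (2 * pi * a * c) * theta k a c t)"
    using ab by blast
  also have "\<dots> = (-1) ^ k * cis (- 2 * pi * a * c) *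
     ((- \<i>) ^ k * of_real (t powr (- 1 / 2 - real k)) * theta k (1 - c) a (1 / t))"
    by (simp only: eq)
  also have "\<dots> = ((-1) * (- \<i>)) ^ k * cis (- 2 * pi * a * c) * of_real (t powr (- 1 / 2 - real k)) * theta k (1 - c) a (1 / t)"
    unfolding power_mult_distrib by (simp only: mult_ac)
  also have "(-1) * (- \<i>) = \<i>" by simp
  finally show ?thesis .
qed

section \<open>Mellin integrals over the unit interval\<close>

text \<open>
  Mellin integrals over \<open>t \<ge> 1\<close> are written in \<open>x = 1 / t\<close>, over the compact interval \<open>[0, 1]\<close>. At
  \<open>x = 0\<close> the factor \<open>of_real x powr _\<close> is \<open>0\<close>, which makes the value of \<open>1 / x\<close> there irrelevant.
\<close>

lemma exp_neg_inverse_mult_powr_bound: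
  fixes w R :: real
  assumes w: "w > 0"
  obtains C where "C \<ge> 0"
    "\<And>r x. r \<le> R \<Longrightarrow> x \<in> {0<..1} \<Longrightarrow> exp (- w / x) * x powr (- r - 1) \<le> C * x\<^sup>2"
proof
  \<comment> \<open>The exponential is compared with (1 + y / n)^n for y = w / x, which gives exp (-
    w / x) <= (n / w)^n x^n. Then n >= R + 3 leaves at least x^2 after multiplication by x^(-r-1).
    The second power of x is a reserve that later absorbs a logarithm.\<close>
  define n where "n = nat \<lceil>\<bar>R\<bar>\<rceil> + 3"
  have n: "real n \<ge> R + 3" "n > 0" unfolding n_def by linarith+
  show "(real n / w) ^ n \<ge> 0" using w by simp
  fix r x :: real assume r: "r \<le> R" and x: "x \<in> {0<..1}"
  then have x0: "0 < x" "x \<le> 1" by auto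
  have "(w / x / real n) ^ n \<le> (1 + (w / x) / real n) ^ n"
    using w x0 n by (intro power_mono) auto
  also have "\<dots> \<le> exp (w / x)"
    using w x0 n by (intro exp_ge_one_plus_x_over_n_power_n) (auto intro: order_trans[of _ 0])
  finally have "exp (- w / x) \<le> 1 / (w / x / real n) ^ n"
    using w x0 n by (simp add: exp_minus field_simps)
  also have "\<dots> = (real n / w) ^ n * x powr real n"
    using w x0 n by (simp add: power_divide powr_realpow power_mult_distrib)
  finally have "exp (- w / x) * x powr (- r - 1) \<le> (real n / w) ^ n * x powr real n * x powr (- r - 1)"
    by (intro mult_right_mono) auto
  also have "\<dots> = (real n / w) ^ n * x powr (real n - r - 1)"
    by (simp add: powr_add[symmetric] algebra_simps)
  also have "\<dots> \<le> (real n / w) ^ n * x powr 2"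
    using n r x0 w by (intro mult_left_mono powr_mono') auto
  finally show "exp (- w / x) * x powr (- r - 1) \<le> (real n / w) ^ n * x\<^sup>2" using x0 by simp
qed

text \<open>A bound C x that is locally uniform in the parameter forces the limit 0 at x = 0. It
  brings the integrands to the compact interval [0, 1], where the rules for continuity and
  differentiation of parameter integrals apply.\<close>

lemma continuous_on_extend_by_zero:
  fixes f :: "'a::metric_space \<times> real \<Rightarrow> complex"
  assumes pos: "continuous_on (A \<times> {0<..1}) f"
    and zero: "\<And>a. a \<in> A \<Longrightarrow> f (a, 0) = 0"
    and bound: "\<And>b. b \<in> A \<Longrightarrow> \<exists>d>0. \<exists>C. \<forall>a\<in>A. \<forall>x\<in>{0<..1}. dist a b < d \<longrightarrow> norm (f (a, x)) \<le> C * x"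
  shows "continuous_on (A \<times> {0..1}) f"
  unfolding continuous_on_def
proof
  fix p assume "p \<in> A \<times> {0..1::real}"
  then obtain b y where p: "p = (b, y)" "b \<in> A" "y \<in> {0..1}" by auto
  show "(f \<longlongrightarrow> f p) (at p within A \<times> {0..1})"
  proof (cases "y = 0")
    case False
    have "at p within A \<times> {0..1} = at p within A \<times> {0<..1}"
      by (rule at_within_nhd[of _ "UNIV \<times> {0<..}"]) (use p False in \<open>auto intro!: open_Times\<close>)
    then show ?thesis using pos p False by (auto simp: continuous_on_def)
  next
    case True
    obtain d C where d: "d > 0" "\<And>a x. a \<in> A \<Longrightarrow> x \<in> {0<..1} \<Longrightarrow> dist a b < d \<Longrightarrow> norm (f (a, x)) \<le> C * x"
      using bound[OF p(2)] by blast
    have "(f \<longlongrightarrow> 0) (at p within A \<times> {0..1})"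
    proof (rule Lim_null_comparison)
      have "norm (f q) \<le> \<bar>C\<bar> * snd q" if q: "q \<in> A \<times> {0..1}" "dist q p < d" for q
      proof (cases "snd q = 0")
        case True
        then show ?thesis using zero[of "fst q"] q by (cases q) auto
      next
        case False
        have "dist (fst q) b < d" using dist_fst_le[of q p] q p by simp
        then have "norm (f q) \<le> C * snd q" using d(2)[of "fst q" "snd q"] q False by (cases q) auto
        also have "\<dots> \<le> \<bar>C\<bar> * snd q" using q by (intro mult_right_mono) auto
        finally show ?thesis .
      qed
      then show "\<forall>\<^sub>F q in at p within A \<times> {0..1}. norm (f q) \<le> \<bar>C\<bar> * snd q"
        using d(1) unfolding eventually_at by blast
      have "((\<lambda>q. \<bar>C\<bar> * snd q) \<longlongrightarrow> \<bar>C\<bar> * snd p) (at p within A \<times> {0..1})"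
        by (intro tendsto_intros)
      then show "((\<lambda>q. \<bar>C\<bar> * snd q) \<longlongrightarrow> 0) (at p within A \<times> {0..1})" using True p by simp
    qed
    then show ?thesis using True p zero by simp
  qed
qed

lemma continuous_on_kernel_integral:
  fixes q :: "'a::metric_space \<Rightarrow> real \<Rightarrow> complex"
  assumes q: "continuous_on (A \<times> {0<..1}) (\<lambda>(p, x). q p x)"
    and B: "\<And>p x. p \<in> A \<Longrightarrow> x \<in> {0<..1} \<Longrightarrow> norm (q p x) \<le> B * exp (- w / x)"
    and w: "w > 0"
  shows "continuous_on A (\<lambda>p. integral {0..1} (\<lambda>x. q p x * of_real x powr (- z - 1)))"
proof -
  obtain C where C: "C \<ge> 0"
    "\<And>r x. r \<le> Re z \<Longrightarrow> x \<in> {0<..1} \<Longrightarrow> exp (- w / x) * x powr (- r - 1) \<le> C * x\<^sup>2"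
    using exp_neg_inverse_mult_powr_bound[OF w] by blast
  have "continuous_on (A \<times> {0..1}) (\<lambda>(p, x). q p x * of_real x powr (- z - 1))"
  proof (rule continuous_on_extend_by_zero)
    show "continuous_on (A \<times> {0<..1}) (\<lambda>(p, x). q p x * of_real x powr (- z - 1))"
      using q unfolding split_beta by (intro continuous_intros) auto
    have "norm (q p x * of_real x powr (- z - 1)) \<le> (\<bar>B\<bar> * C) * x" if px: "p \<in> A" "x \<in> {0<..1}" for p x
    proof -
      have "norm (q p x * of_real x powr (- z - 1)) \<le> \<bar>B\<bar> * exp (- w / x) * x powr (- Re z - 1)"
        unfolding norm_mult using px B[OF px] order_trans[OF B[OF px], of "\<bar>B\<bar> * exp (- w / x)"]
        by (intro mult_mono) (auto simp: norm_powr_real_powr)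
      also have "\<dots> \<le> \<bar>B\<bar> * (C * x\<^sup>2)"
        using C(2)[OF order_refl px(2)] by (simp add: mult_left_mono mult.assoc)
      also have "\<dots> \<le> \<bar>B\<bar> * (C * x)"
        using px C by (intro mult_left_mono) (auto simp: power2_eq_square mult_left_le)
      finally show ?thesis by (simp add: mult_ac)
    qed
    then show "\<exists>d>0. \<exists>C. \<forall>a\<in>A. \<forall>x\<in>{0<..1}. dist a b < d \<longrightarrow>
        norm (case (a, x) of (p, x) \<Rightarrow> q p x * of_real x powr (- z - 1)) \<le> C * x" for b
      by (intro exI[of _ 1] conjI exI[of _ "\<bar>B\<bar> * C"]) auto
  qed auto
  then show ?thesis
    using integral_continuous_on_param[of A 0 1 "\<lambda>p x. q p x * of_real x powr (- z - 1)"] by simp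
qed

text \<open>Differentiation under the integral sign. On each half-plane Re z <= R the integrand is
  at most C x^2, and the unit disc around b lies in such a half-plane with R = Re b + 1, so the
  local bounds needed at x = 0 are available.\<close>

lemma holomorphic_kernel_integral:
  fixes q :: "real \<Rightarrow> complex"
  assumes q: "continuous_on {0<..1} q"
    and B: "\<And>x. x \<in> {0<..1} \<Longrightarrow> norm (q x) \<le> B * exp (- w / x)"
    and w: "w > 0"
  shows "(\<lambda>z. integral {0..1} (\<lambda>x. q x * of_real x powr (- z - 1))) holomorphic_on UNIV"
    and "continuous_on {0..1} (\<lambda>x. q x * of_real x powr (- z - 1))"
proof -
  have bound: "\<exists>C\<ge>0. \<forall>z x. Re z \<le> R \<longrightarrow> x \<in> {0<..1} \<longrightarrow> norm (q x * of_real x powr (- z - 1)) \<le> C * x\<^sup>2" for R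
  proof -
    obtain C where C: "C \<ge> 0"
      "\<And>r x. r \<le> R \<Longrightarrow> x \<in> {0<..1} \<Longrightarrow> exp (- w / x) * x powr (- r - 1) \<le> C * x\<^sup>2"
      using exp_neg_inverse_mult_powr_bound[OF w] by blast
    have "norm (q x * of_real x powr (- z - 1)) \<le> (\<bar>B\<bar> * C) * x\<^sup>2" if zx: "Re z \<le> R" "x \<in> {0<..1}" for z x
    proof -
      have "norm (q x * of_real x powr (- z - 1)) \<le> \<bar>B\<bar> * exp (- w / x) * x powr (- Re z - 1)"
        unfolding norm_mult using zx B[OF zx(2)] order_trans[OF B[OF zx(2)], of "\<bar>B\<bar> * exp (- w / x)"]
        by (intro mult_mono) (auto simp: norm_powr_real_powr)
      also have "\<dots> \<le> \<bar>B\<bar> * (C * x\<^sup>2)"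
        using C(2)[OF zx] by (simp add: mult_left_mono mult.assoc)
      finally show ?thesis by (simp add: mult_ac)
    qed
    then show ?thesis using C(1) by (intro exI[of _ "\<bar>B\<bar> * C"]) auto
  qed
  have near: "dist a b < 1 \<Longrightarrow> Re a \<le> Re b + 1" for a b :: complex
    using abs_Re_le_cmod[of "a - b"] by (simp add: dist_norm)
  have c1: "continuous_on (UNIV \<times> {0..1}) (\<lambda>(z, x). q x * of_real x powr (- z - 1))"
  proof (rule continuous_on_extend_by_zero)
    show "continuous_on (UNIV \<times> {0<..1}) (\<lambda>(z, x). q x * of_real x powr (- z - 1))"
      unfolding split_beta by (intro continuous_intros continuous_on_compose2[OF q]) auto
    fix b :: complex
    obtain C where C: "C \<ge> 0" "\<And>z x. Re z \<le> Re b + 1 \<Longrightarrow> x \<in> {0<..1} \<Longrightarrow> norm (q x * of_real x powr (- z - 1)) \<le> C * x\<^sup>2"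
      using bound by blast
    have "C * x\<^sup>2 \<le> C * x" if "x \<in> {0<..1}" for x
      using that C(1) by (auto simp: power2_eq_square mult_left_le intro!: mult_left_mono)
    then have "norm (q x * of_real x powr (- z - 1)) \<le> C * x" if "dist z b < 1" "x \<in> {0<..1}" for z x
      using C(2)[OF near[OF that(1)] that(2)] that by fastforce
    then show "\<exists>d>0. \<exists>C. \<forall>a\<in>UNIV. \<forall>x\<in>{0<..1}. dist a b < d \<longrightarrow>
        norm (case (a, x) of (z, x) \<Rightarrow> q x * of_real x powr (- z - 1)) \<le> C * x"
      by (intro exI[of _ 1] conjI exI[of _ C]) auto
  qed auto
  \<comment> \<open>This is the z-derivative of the integrand. Its logarithm satisfies |ln x| <= 1 /
    x and uses up the spare power in C x^2.\<close>
  have c2: "continuous_on (UNIV \<times> {0..1}) (\<lambda>(z, x). - of_real (ln x) * (q x * of_real x powr (- z - 1)))"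
  proof (rule continuous_on_extend_by_zero)
    show "continuous_on (UNIV \<times> {0<..1}) (\<lambda>(z, x). - of_real (ln x) * (q x * of_real x powr (- z - 1)))"
      unfolding split_beta by (intro continuous_intros continuous_on_compose2[OF q]) auto
    fix b :: complex
    obtain C where C: "C \<ge> 0" "\<And>z x. Re z \<le> Re b + 1 \<Longrightarrow> x \<in> {0<..1} \<Longrightarrow> norm (q x * of_real x powr (- z - 1)) \<le> C * x\<^sup>2"
      using bound by blast
    have "norm (- of_real (ln x) * (q x * of_real x powr (- z - 1))) \<le> C * x" if zx: "dist z b < 1" "x \<in> {0<..1}" for z x
    proof -
      have "\<bar>ln x\<bar> = ln (1 / x)" using zx by (simp add: ln_div)
      also have "\<dots> \<le> 1 / x" using zx ln_bound[of "1 / x"] by simp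
      finally have "norm (- of_real (ln x) * (q x * of_real x powr (- z - 1))) \<le> (1 / x) * (C * x\<^sup>2)"
        unfolding norm_mult norm_minus_cancel norm_of_real unfolding norm_mult[symmetric]
        using C(2)[OF near[OF zx(1)] zx(2)] zx by (intro mult_mono) auto
      also have "\<dots> = C * x" using zx by (simp add: power2_eq_square)
      finally show ?thesis .
    qed
    then show "\<exists>d>0. \<exists>C. \<forall>a\<in>UNIV. \<forall>x\<in>{0<..1}. dist a b < d \<longrightarrow>
        norm (case (a, x) of (z, x) \<Rightarrow> - of_real (ln x) * (q x * of_real x powr (- z - 1))) \<le> C * x"
      by (intro exI[of _ 1] conjI exI[of _ C]) auto
  qed auto
  show c: "continuous_on {0..1} (\<lambda>x. q x * of_real x powr (- z - 1))" for z
  proof -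
    have "continuous_on {0..1} (\<lambda>x. case (z, x) of (z, x) \<Rightarrow> q x * of_real x powr (- z - 1))"
      by (rule continuous_on_compose2[OF c1]) (auto intro!: continuous_on_Pair)
    then show ?thesis by simp
  qed
  have "(\<lambda>z. integral (cbox 0 1) (\<lambda>x. q x * of_real x powr (- z - 1))) holomorphic_on UNIV"
  proof (rule leibniz_rule_holomorphic)
    show "((\<lambda>z. q x * of_real x powr (- z - 1)) has_field_derivative
       - of_real (ln x) * (q x * of_real x powr (- z - 1))) (at z within UNIV)" if "x \<in> cbox 0 1" for z x
    proof (cases "x = 0")
      case False
      then have "((\<lambda>z. of_real x powr (- z - 1)) has_field_derivative
         (Ln (of_real x) * of_real x powr (- z - 1)) * (- 1)) (at z)"
        by (intro DERIV_chain2[where g = "\<lambda>z. - z - 1"] derivative_eq_intros) auto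
      from DERIV_cmult[OF this, of "q x"] show ?thesis
        using that False by (simp add: Ln_of_real mult_ac)
    qed simp
    show "(\<lambda>x. q x * of_real x powr (- z - 1)) integrable_on cbox 0 1" for z
      using integrable_continuous_real[OF c] by simp
    show "continuous_on (UNIV \<times> cbox 0 1) (\<lambda>(z, x). - of_real (ln x) * (q x * of_real x powr (- z - 1)))"
      using c2 by simp
  qed simp
  then show "(\<lambda>z. integral {0..1} (\<lambda>x. q x * of_real x powr (- z - 1))) holomorphic_on UNIV" by simp
qed

lemma set_integrable_insert_zero:
  fixes f :: "real \<Rightarrow> complex"
  assumes "f absolutely_integrable_on {0<..1}" "f 0 = 0"
  shows "f absolutely_integrable_on {0..1}"
proof -
  have eq: "(\<lambda>x. indicator {0..1} x *\<^sub>R f x) = (\<lambda>x. indicator {0<..1} x *\<^sub>R f x)"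
    using assms(2) by (intro ext) (auto simp: indicator_def)
  show ?thesis using assms(1) unfolding set_integrable_def eq .
qed

text \<open>The scaled Euler integral of exp (- v t) t^(z-1) over t > 0, cut at t = 1, with the
  outer part moved to (0, 1] by t = 1 / x.\<close>

lemma gamma_mellin_split:
  fixes v :: real and z :: complex
  assumes v: "v > 0" and z: "Re z > 0"
  shows "(\<lambda>x. of_real (exp (- v * x)) * of_real x powr (z - 1)) absolutely_integrable_on {0..1}"
    "(\<lambda>x. of_real (exp (- v / x)) * of_real x powr (- z - 1)) absolutely_integrable_on {0..1}"
    "integral {0..1} (\<lambda>x. of_real (exp (- v * x)) * of_real x powr (z - 1)) +
     integral {0..1} (\<lambda>x. of_real (exp (- v / x)) * of_real x powr (- z - 1)) =
     Gamma z * of_real v powr (- z)"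
proof -
  define F where "F x = of_real (exp (- v * x)) * of_real x powr (z - 1)" for x
  define E where "E x = of_real (exp (- v / x)) * of_real x powr (- z - 1)" for x
  define f where "f t = of_real t powr (z - 1) / of_real (exp t)" for t :: real
  have f: "f absolutely_integrable_on {0<..}" "integral {0<..} f = Gamma z"
    unfolding f_def using absolutely_integrable_Gamma_integral'[OF z] Gamma_integral_complex'[OF z]
    by (auto simp: integral_unique)
  have im: "(\<lambda>x. v * x) ` {0<..} = {0<..}"
  proof -
    have "x \<in> (\<lambda>x. v * x) ` {0<..}" if "x > 0" for x
      using that v by (intro image_eqI[of _ _ "x / v"]) auto
    then show ?thesis using v by auto
  qed
  have inj: "inj_on (\<lambda>x. v * x) {0<..}" using v by (auto intro!: inj_onI)
  have cv: "(\<lambda>x. \<bar>v\<bar> *\<^sub>R f (v * x)) absolutely_integrable_on {0<..} \<and>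
      integral {0<..} (\<lambda>x. \<bar>v\<bar> *\<^sub>R f (v * x)) = Gamma z"
    using has_absolute_integral_change_of_variables_real[of "{0<..}" "\<lambda>x. v * x" "\<lambda>x. v" f "Gamma z"] f im v inj
    by (auto intro!: derivative_eq_intros)
  have FX: "F x = of_real v powr (- z) * (\<bar>v\<bar> *\<^sub>R f (v * x))" if "x \<in> {0<..}" for x
  proof -
    have "of_real (v * x) powr (z - 1) = of_real v powr (z - 1) * of_real x powr (z - 1)"
      using v that by (simp add: powr_times_real)
    moreover have "of_real v powr (- z) * (of_real v * of_real v powr (z - 1)) = 1"
      using v by (simp add: powr_diff powr_minus field_simps)
    ultimately show ?thesis using v
      by (simp add: F_def f_def scaleR_conv_of_real exp_minus field_simps)
  qed
  have F: "F absolutely_integrable_on {0<..}" "integral {0<..} F = of_real v powr (- z) * Gamma z"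
  proof -
    show "F absolutely_integrable_on {0<..}"
      by (subst set_integrable_cong[OF refl refl FX]) (assumption | rule set_integrable_mult_right conjunct1[OF cv])+
    show "integral {0<..} F = of_real v powr (- z) * Gamma z"
    proof -
      have "integral {0<..} F = integral {0<..} (\<lambda>x. of_real v powr (- z) * (\<bar>v\<bar> *\<^sub>R f (v * x)))"
        by (rule integral_cong) (rule FX)
      also have "\<dots> = of_real v powr (- z) * integral {0<..} (\<lambda>x. \<bar>v\<bar> *\<^sub>R f (v * x))"
        by (rule integral_mult_right)
      finally show ?thesis by (simp only: conjunct2[OF cv])
    qed
  qed
  have im2: "(\<lambda>x. 1 / x) ` {0<..1} = {1::real..}"
  proof -
    have "{1..} \<subseteq> (\<lambda>x. 1 / x) ` {0<..1::real}"
    proof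
      fix x :: real assume "x \<in> {1..}"
      then show "x \<in> (\<lambda>x. 1 / x) ` {0<..1}" by (intro image_eqI[of _ _ "1 / x"]) auto
    qed
    moreover have "(\<lambda>x. 1 / x) ` {0<..1::real} \<subseteq> {1..}"
      by (intro image_subsetI) simp
    ultimately show ?thesis by blast
  qed
  have inj2: "inj_on (\<lambda>x. 1 / x) {0<..1::real}" by (auto intro!: inj_onI)
  have F1: "F absolutely_integrable_on {0<..1}" "F absolutely_integrable_on {1..}"
    by (rule set_integrable_subset[OF F(1)]; force)+
  have d2: "((\<lambda>x. 1 / x) has_real_derivative - 1 / x\<^sup>2) (at x within {0<..1})" if "x \<in> {0<..1}" for x
    using that by (auto intro!: derivative_eq_intros simp: power2_eq_square)
  \<comment> \<open>The Jacobian 1 / x^2 of t = 1 / x turns (1 / x)^(z-1) into x^(-z-1), the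
    exponent used in all integrals over t >= 1.\<close>
  have cv2: "(\<lambda>x. \<bar>- 1 / x\<^sup>2\<bar> *\<^sub>R F (1 / x)) absolutely_integrable_on {0<..1} \<and>
      integral {0<..1} (\<lambda>x. \<bar>- 1 / x\<^sup>2\<bar> *\<^sub>R F (1 / x)) = integral {1..} F"
    using has_absolute_integral_change_of_variables_real[OF _ d2 inj2, where f = F and b = "integral {1..} F"] F1(2)
    unfolding im2 by simp
  have EX: "E x = \<bar>- 1 / x\<^sup>2\<bar> *\<^sub>R F (1 / x)" if "x \<in> {0<..1}" for x
  proof -
    have "of_real (1 / x) powr (z - 1) = of_real x powr (1 - z)"
    proof -
      have "of_real (1 / x) powr (z - 1) * of_real x powr (z - 1) = 1"
        using powr_times_real[of "of_real (1 / x)" "of_real x" "z - 1"] that by simp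
      moreover have "of_real x powr (1 - z) = inverse (of_real x powr (z - 1))"
        using powr_minus[of "of_real x" "z - 1"] by simp
      ultimately show ?thesis by (metis inverse_unique mult.commute)
    qed
    moreover have "of_real x powr (1 - z) = of_real x powr (- z - 1) * of_real x powr 2"
      unfolding powr_add[symmetric] by simp
    moreover have "of_real x powr 2 = complex_of_real (x\<^sup>2)"
      using that powr_nat'[of "of_real x" 2] by simp
    ultimately show ?thesis using that
      by (simp add: E_def F_def scaleR_conv_of_real)
  qed
  have E: "E absolutely_integrable_on {0<..1}" "integral {0<..1} E = integral {1..} F"
  proof -
    show "E absolutely_integrable_on {0<..1}"
      by (subst set_integrable_cong[OF refl refl EX]) (assumption | rule conjunct1[OF cv2])+
    show "integral {0<..1} E = integral {1..} F"
      unfolding conjunct2[OF cv2, symmetric] by (rule integral_cong) (rule EX)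
  qed
  have FE: "F absolutely_integrable_on {0..1}" "E absolutely_integrable_on {0..1}"
    by (rule set_integrable_insert_zero; use F1 E in \<open>simp add: F_def E_def\<close>)+
  then show "(\<lambda>x. of_real (exp (- v * x)) * of_real x powr (z - 1)) absolutely_integrable_on {0..1}"
    "(\<lambda>x. of_real (exp (- v / x)) * of_real x powr (- z - 1)) absolutely_integrable_on {0..1}"
    by (simp_all add: F_def[abs_def] E_def[abs_def])
  have z1: "integral {0..1} h = integral {0<..1} h" if "h 0 = 0" for h :: "real \<Rightarrow> complex"
    by (rule integral_spike_set) (auto intro: negligible_subset[of "{0}"])
  have "(F has_integral (integral {0<..1} F + integral {1..} F)) ({0<..1} \<union> {1..})"
    using F1 by (intro has_integral_Un integrable_integral)
      (auto intro: set_lebesgue_integral_eq_integral(1) negligible_subset[of "{1}"])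
  moreover have "{0<..1} \<union> {1..} = {0::real<..}" by auto
  ultimately have "integral {0<..1} F + integral {0<..1} E = of_real v powr (- z) * Gamma z"
    using F(2) E(2) by (simp add: integral_unique)
  moreover have "F 0 = 0" "E 0 = 0" by (simp_all add: F_def E_def)
  ultimately show "integral {0..1} (\<lambda>x. of_real (exp (- v * x)) * of_real x powr (z - 1)) +
     integral {0..1} (\<lambda>x. of_real (exp (- v / x)) * of_real x powr (- z - 1)) =
     Gamma z * of_real v powr (- z)"
    using z1[of F] z1[of E] by (simp add: F_def[abs_def] E_def[abs_def] mult.commute)
qed

section \<open>The theta series without its two innermost summands\<close>

definition theta_tail :: "nat \<Rightarrow> real \<Rightarrow> real \<Rightarrow> real \<Rightarrow> complex" where
  "theta_tail k a c t = (\<Sum>n. theta_term k a c (int (Suc n)) t + theta_term k a c (-1 - int (Suc n)) t)"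

lemma theta_eq_tail:
  assumes "t > 0" "k \<in> {0, 1}" "c \<in> {0..1}"
  shows "theta k a c t = theta_term k a c 0 t + theta_term k a c (-1) t + theta_tail k a c t"
  unfolding theta_def theta_tail_def
  using suminf_split_head[OF summable_theta[OF assms, of a]] by simp

text \<open>All indices here have |n + c| >= 1 for every c in [0, 1]. One factor exp (- pi t) is
  split off as the common decay rate and the remaining power is evaluated at t = 1, so the majorant
  is uniform in t >= 1, a and c.\<close>

lemma norm_theta_tail_term_le:
  assumes "t \<ge> 1" "k \<in> {0, 1}" "c \<in> {0..1}"
  shows "norm (theta_term k a c (int (Suc n)) t + theta_term k a c (-1 - int (Suc n)) t)
    \<le> 2 * (real (Suc (Suc n)) * exp (- pi) ^ n) * exp (- pi * t)"
proof -
  have "norm (theta_term k a c (int (Suc n)) t + theta_term k a c (-1 - int (Suc n)) t)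
     \<le> real (Suc (Suc n)) * exp (- pi * t) ^ Suc n + real (Suc (Suc n)) * exp (- pi * t) ^ Suc n"
    using assms by (intro norm_triangle_mono norm_theta_term_le) auto
  also have "\<dots> = 2 * (real (Suc (Suc n)) * exp (- pi * t) ^ n) * exp (- pi * t)" by simp
  also have "\<dots> \<le> 2 * (real (Suc (Suc n)) * exp (- pi) ^ n) * exp (- pi * t)"
    using assms by (intro mult_right_mono mult_left_mono power_mono) auto
  finally show ?thesis .
qed

lemma summable_theta_tail_bound: "summable (\<lambda>n. 2 * (real (Suc (Suc n)) * exp (- pi) ^ n))"
proof -
  have "summable (\<lambda>n. real (Suc n) * exp (- pi) ^ n + exp (- pi) ^ n)"
    using summable_Suc_mult_exp_power[of 1] by (intro summable_add summable_geometric) auto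
  then show ?thesis by (intro summable_mult) (simp add: algebra_simps)
qed

lemma norm_theta_tail_le:
  obtains B where "\<And>k a c t. t \<ge> 1 \<Longrightarrow> k \<in> {0, 1} \<Longrightarrow> c \<in> {0..1} \<Longrightarrow> norm (theta_tail k a c t) \<le> B * exp (- pi * t)"
proof
  fix k :: nat and a c t :: real assume *: "t \<ge> 1" "k \<in> {0, 1}" "c \<in> {0..1}"
  show "norm (theta_tail k a c t) \<le> (\<Sum>n. 2 * (real (Suc (Suc n)) * exp (- pi) ^ n)) * exp (- pi * t)"
    unfolding theta_tail_def suminf_mult2[OF summable_theta_tail_bound]
    by (rule norm_suminf_le[OF norm_theta_tail_term_le[OF *] summable_mult2[OF summable_theta_tail_bound]])
qed

lemma continuous_on_theta_term [continuous_intros]: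
  assumes "continuous_on S a" "continuous_on S c" "continuous_on S t"
  shows "continuous_on S (\<lambda>p. theta_term k (a p) (c p) n (t p))"
  unfolding theta_term_def by (intro continuous_intros assms)

lemma continuous_on_theta_tail:
  assumes "k \<in> {0, 1}"
  shows "continuous_on (({0..1} \<times> {0..1}) \<times> {0<..1}) (\<lambda>(p, x). theta_tail k (fst p) (snd p) (1 / x))"
  unfolding theta_tail_def split_beta
proof (rule continuous_on_dominated_suminf[OF _ _ summable_theta_tail_bound])
  fix n and q :: "(real \<times> real) \<times> real" assume q: "q \<in> ({0..1} \<times> {0..1}) \<times> {0<..1}"
  then have "norm (theta_term k (fst (fst q)) (snd (fst q)) (int (Suc n)) (1 / snd q) +
      theta_term k (fst (fst q)) (snd (fst q)) (-1 - int (Suc n)) (1 / snd q))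
     \<le> 2 * (real (Suc (Suc n)) * exp (- pi) ^ n) * exp (- pi * (1 / snd q))"
    using assms by (intro norm_theta_tail_term_le) auto
  also have "\<dots> \<le> 2 * (real (Suc (Suc n)) * exp (- pi) ^ n) * 1"
    using q by (intro mult_left_mono) auto
  finally show "norm (theta_term k (fst (fst q)) (snd (fst q)) (int (Suc n)) (1 / snd q) +
      theta_term k (fst (fst q)) (snd (fst q)) (-1 - int (Suc n)) (1 / snd q))
     \<le> 2 * (real (Suc (Suc n)) * exp (- pi) ^ n)" by simp
qed (intro continuous_intros, auto)

section \<open>Termwise Mellin transform of theta and the Dirichlet series\<close>

text \<open>\<open>j\<close> is the Mellin integrand on t > 0 folded onto [0, 1] by t = 1 / x. The
  L1 bound comes from the same computation at the real exponent \<open>Re z\<close>, where the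
  dominating integrand is nonnegative; it is what justifies exchanging the sum over n with the
  integral.\<close>

lemma theta_term_mellin:
  fixes z :: complex and n :: int and a c :: real and k :: nat
  assumes z: "Re z > 0" and y: "of_int n + c \<noteq> 0"
  defines "j \<equiv> \<lambda>x. theta_term k a c n x * of_real x powr (z - 1) + theta_term k a c n (1 / x) * of_real x powr (- z - 1)"
  shows "j absolutely_integrable_on {0..1}"
    and "integral {0..1} j = cis (2 * pi * of_int n * a) * of_real ((of_int n + c) ^ k) *
           (Gamma z * of_real (pi * (of_int n + c)\<^sup>2) powr (- z))"
    and "integral {0..1} (\<lambda>x. norm (j x)) \<le> \<bar>of_int n + c\<bar> ^ k * (Gamma (Re z) * (pi * (of_int n + c)\<^sup>2) powr (- Re z))"
proof -
  define y where "y = of_int n + c"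
  define v where "v = pi * y\<^sup>2"
  have v: "v > 0" using assms by (simp add: v_def y_def)
  define w where "w = cis (2 * pi * of_int n * a) * of_real (y ^ k)"
  note G = gamma_mellin_split[OF v z]
  let ?F = "\<lambda>z x. of_real (exp (- v * x)) * of_real x powr (z - 1) :: complex"
  let ?E = "\<lambda>z x. of_real (exp (- v / x)) * of_real x powr (- z - 1) :: complex"
  have j: "j = (\<lambda>x. w * (?F z x + ?E z x))"
    by (intro ext) (simp add: j_def w_def theta_term_def v_def y_def algebra_simps)
  show int: "j absolutely_integrable_on {0..1}"
    unfolding j by (intro set_integrable_mult_right set_integral_add G)
  show "integral {0..1} j = cis (2 * pi * of_int n * a) * of_real ((of_int n + c) ^ k) *
           (Gamma z * of_real (pi * (of_int n + c)\<^sup>2) powr (- z))"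
    unfolding j using G
    by (subst integral_mult_right, subst integral_add)
       (auto simp: w_def v_def y_def dest: set_lebesgue_integral_eq_integral(1))
  have r: "Re (of_real (Re z)) > 0" using z by simp
  note H = gamma_mellin_split[OF v r]
  let ?J = "\<lambda>x. ?F (of_real (Re z)) x + ?E (of_real (Re z)) x"
  have J: "(?J has_integral Gamma (of_real (Re z)) * of_real v powr (- of_real (Re z))) {0..1}"
    unfolding H(3)[symmetric] using H(1,2)
    by (intro has_integral_add integrable_integral) (auto dest: set_lebesgue_integral_eq_integral(1))
  have J': "((\<lambda>x. \<bar>y\<bar> ^ k * Re (?J x)) has_integral \<bar>y\<bar> ^ k * (Gamma (Re z) * v powr (- Re z))) {0..1}"
  proof -
    have "Gamma (of_real (Re z)) * complex_of_real v powr (- of_real (Re z)) = of_real (Gamma (Re z) * v powr (- Re z))"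
      using v powr_of_real[of v "- Re z"] by (simp add: Gamma_complex_of_real)
    then have "Re (Gamma (of_real (Re z)) * complex_of_real v powr (- of_real (Re z))) = Gamma (Re z) * v powr (- Re z)"
      by (simp only: Re_complex_of_real)
    with has_integral_mult_right[OF has_integral_linear[OF J bounded_linear_Re], of "\<bar>y\<bar> ^ k"]
    show ?thesis by (simp add: o_def)
  qed
  have "integral {0..1} (\<lambda>x. norm (j x)) \<le> integral {0..1} (\<lambda>x. \<bar>y\<bar> ^ k * Re (?J x))"
  proof (rule integral_le)
    show "(\<lambda>x. norm (j x)) integrable_on {0..1}"
      using int by (simp add: absolutely_integrable_on_def)
    show "(\<lambda>x. \<bar>y\<bar> ^ k * Re (?J x)) integrable_on {0..1}" using J' by blast
    fix x :: real assume x: "x \<in> {0..1}"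
    have "norm (j x) \<le> \<bar>y\<bar> ^ k * (exp (- v * x) * x powr (Re z - 1) + exp (- v / x) * x powr (- Re z - 1))"
      unfolding j norm_mult using x
      by (intro mult_mono order_trans[OF norm_triangle_ineq])
         (auto simp: w_def norm_mult norm_power power_abs norm_powr_real_powr)
    also have "exp (- v * x) * x powr (Re z - 1) + exp (- v / x) * x powr (- Re z - 1) = Re (?J x)"
    proof -
      have "complex_of_real x powr (of_real (Re z) - 1) = of_real (x powr (Re z - 1))"
        "complex_of_real x powr (- of_real (Re z) - 1) = of_real (x powr (- Re z - 1))"
        using x powr_of_real[of x "Re z - 1"] powr_of_real[of x "- Re z - 1"] by simp_all
      then have "?J x = of_real (exp (- v * x) * x powr (Re z - 1) + exp (- v / x) * x powr (- Re z - 1))"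
        by simp
      then show ?thesis by (simp only: Re_complex_of_real)
    qed
    finally show "norm (j x) \<le> \<bar>y\<bar> ^ k * Re (?J x)" .
  qed
  also have "\<dots> = \<bar>y\<bar> ^ k * (Gamma (Re z) * v powr (- Re z))" using J' by (rule integral_unique)
  finally show "integral {0..1} (\<lambda>x. norm (j x)) \<le> \<bar>of_int n + c\<bar> ^ k * (Gamma (Re z) * (pi * (of_int n + c)\<^sup>2) powr (- Re z))"
    by (simp add: y_def v_def)
qed

text \<open>This fixes the choice z = (s + k) / 2: the power y^k of the theta summand compensates
  the excess y^(-k) in (y^2)^(-z).\<close>

lemma power_mult_pi_square_powr:
  assumes y: "y > 0"
  shows "of_real (y ^ k) * of_real (pi * y\<^sup>2) powr (- ((s + of_nat k) / 2)) =
    complex_of_real pi powr (- ((s + of_nat k) / 2)) * of_real y powr (- s)"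
proof -
  let ?z = "(s + of_nat k) / 2"
  have "complex_of_real (pi * y\<^sup>2) powr (- ?z) = of_real pi powr (- ?z) * (of_real y powr (- ?z) * of_real y powr (- ?z))"
    using y by (simp add: powr_times_real power2_eq_square)
  also have "of_real y powr (- ?z) * of_real y powr (- ?z) = complex_of_real y powr (- s - of_nat k)"
    unfolding powr_add[symmetric] by simp
  finally have "of_real (y ^ k) * of_real (pi * y\<^sup>2) powr (- ?z) =
      of_real pi powr (- ?z) * (of_real y powr of_nat k * of_real y powr (- s - of_nat k))"
    using y by simp
  also have "of_real y powr of_nat k * of_real y powr (- s - of_nat k) = complex_of_real y powr (- s)"
    unfolding powr_add[symmetric] by simp
  finally show ?thesis .
qed

lemma summable_real_shift_powr:
  assumes "c > 0" "r > 1"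
  shows "summable (\<lambda>n. (real n + c) powr (- r))"
proof (rule summable_comparison_test_ev)
  show "summable (\<lambda>n. real n powr (- r))" using assms by (subst summable_real_powr_iff) auto
  show "eventually (\<lambda>n. norm ((real n + c) powr (- r)) \<le> real n powr (- r)) sequentially"
    using eventually_gt_at_top[of 0]
  proof eventually_elim
    case (elim n)
    then show ?case using assms by (auto intro!: powr_mono2')
  qed
qed

lemma summable_lerch_zeta_series:
  assumes "c > 0" "Re s > 1"
  shows "summable (\<lambda>n. cis (2 * pi * real n * a) * complex_of_real (real n + c) powr (- s))"
  by (rule summable_comparison_test'[OF summable_real_shift_powr[OF assms], of 0])
    (use assms in \<open>auto simp: norm_mult norm_powr_real_powr simp del: of_real_add\<close>)

text \<open>Summing the Mellin transforms of the theta summands. The L1 norms of the pairs are at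
  most C ((n + c)^(-Re s) + (n + 1 - c)^(-Re s)), which is summable exactly because Re s >
  1.\<close>

lemma lerch_series_eq_theta_integral:
  assumes k: "k \<in> {0, 1}" and c: "c \<in> {0<..<1}" and s: "Re s > 1" and z_def: "z = (s + of_nat k) / 2"
  shows "Gamma z * of_real pi powr (- z) *
      (lerch_zeta_series s a c + (-1) ^ k * cis (- 2 * pi * a) * lerch_zeta_series s (1 - a) (1 - c)) =
    integral {0..1} (\<lambda>x. theta k a c x * of_real x powr (z - 1) + theta k a c (1 / x) * of_real x powr (- z - 1))"
proof -
  define j where "j n x = theta_term k a c n x * of_real x powr (z - 1) + theta_term k a c n (1 / x) * of_real x powr (- z - 1)"
    for n x
  define u where "u n x = j (int n) x + j (-1 - int n) x" for n x
  define C where "C = Gamma (Re z) * pi powr (- Re z)"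
  have z: "Re z > 0" using s by (simp add: z_def)
  have ne: "of_int n + c \<noteq> 0" for n
  proof
    assume "of_int n + c = 0"
    then have "real_of_int n < 0" "real_of_int n > -1" using c by auto
    then have "n < 0" "n > -1" by linarith+
    then show False by simp
  qed
  have J: "j n absolutely_integrable_on {0..1}"
    "integral {0..1} (j n) = cis (2 * pi * of_int n * a) * of_real ((of_int n + c) ^ k) *
           (Gamma z * of_real (pi * (of_int n + c)\<^sup>2) powr (- z))"
    "integral {0..1} (\<lambda>x. norm (j n x)) \<le> \<bar>of_int n + c\<bar> ^ k * (Gamma (Re z) * (pi * (of_int n + c)\<^sup>2) powr (- Re z))" for n
    using theta_term_mellin[OF z ne, where n = n and k = k and a = a] unfolding j_def[abs_def] by blast+
  have rp: "\<bar>y\<bar> ^ k * (Gamma (Re z) * (pi * y\<^sup>2) powr (- Re z)) = C * \<bar>y\<bar> powr (- Re s)" if "y \<noteq> 0" for y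
  proof -
    have "norm (of_real (\<bar>y\<bar> ^ k) * complex_of_real (pi * \<bar>y\<bar>\<^sup>2) powr (- z)) =
        norm (complex_of_real pi powr (- z) * of_real \<bar>y\<bar> powr (- s))"
      using power_mult_pi_square_powr[of "\<bar>y\<bar>" k s] that by (simp add: z_def)
    then have "\<bar>y\<bar> ^ k * (pi * y\<^sup>2) powr (- Re z) = pi powr (- Re z) * \<bar>y\<bar> powr (- Re s)"
      by (simp add: norm_mult norm_power norm_powr_real_powr del: of_real_mult of_real_power)
    then show ?thesis by (simp add: C_def)
  qed
  have S1: "summable (\<lambda>n. C * (real n + c) powr (- Re s) + C * (real n + (1 - c)) powr (- Re s))"
    using c s by (intro summable_add summable_mult summable_real_shift_powr) auto
  have iu: "u n absolutely_integrable_on {0..1}" for n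
    unfolding u_def by (intro set_integral_add J)
  have nu: "integral {0..1} (\<lambda>x. norm (u n x)) \<le> C * (real n + c) powr (- Re s) + C * (real n + (1 - c)) powr (- Re s)" for n
  proof -
    have ij: "(\<lambda>x. norm (j m x)) integrable_on {0..1}" for m
      using J(1) by (simp add: absolutely_integrable_on_def)
    have "integral {0..1} (\<lambda>x. norm (u n x)) \<le> integral {0..1} (\<lambda>x. norm (j (int n) x) + norm (j (-1 - int n) x))"
      using iu[of n] by (intro integral_le integrable_add ij)
        (auto simp: absolutely_integrable_on_def u_def norm_triangle_ineq)
    also have "\<dots> = integral {0..1} (\<lambda>x. norm (j (int n) x)) + integral {0..1} (\<lambda>x. norm (j (-1 - int n) x))"
      by (intro integral_add ij)
    also have "\<dots> \<le> C * \<bar>of_int (int n) + c\<bar> powr (- Re s) + C * \<bar>of_int (-1 - int n) + c\<bar> powr (- Re s)"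
      using J(3)[of "int n"] J(3)[of "-1 - int n"] unfolding rp[OF ne] by (rule add_mono)
    also have "\<bar>of_int (int n) + c\<bar> = real n + c" using c by simp
    also have "\<bar>of_int (-1 - int n) + c\<bar> = real n + (1 - c)" using c by simp
    finally show ?thesis .
  qed
  \<comment> \<open>The exchange of sum and integral is a statement about Lebesgue integrals, so the
    gauge integrals are translated there and back.\<close>
  have M: "integrable (lebesgue_on {0..1}) f \<longleftrightarrow> f absolutely_integrable_on {0..1}" for f :: "real \<Rightarrow> complex"
    by (simp add: integrable_restrict_space set_integrable_def)
  have MR: "(LINT x|lebesgue_on {0..1}. norm (f x)) = integral {0..1} (\<lambda>x. norm (f x))"
    if "f absolutely_integrable_on {0..1}" for f :: "real \<Rightarrow> complex"
    using that by (intro lebesgue_integral_eq_integral integrable_norm) (auto simp: M)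
  have th0: "summable (\<lambda>n. norm (theta_term k a c (int n) t))" "summable (\<lambda>n. norm (theta_term k a c (-1 - int n) t))"
    if "t > 0" for t
    by (rule summable_comparison_test'[OF summable_Suc_mult_exp_power[OF that], of 0];
        use norm_theta_term_le[of t k c] that k c in auto)+
  have th: "summable (\<lambda>n. theta_term k a c (int n) t + theta_term k a c (-1 - int n) t)" if "t > 0" for t
    using that k c by (intro summable_theta) auto
  have su: "summable (\<lambda>n. norm (u n x))" if "x \<in> {0..1}" for x
  proof (cases "x = 0")
    case False
    then have x: "x > 0" "1 / x > 0" using that by auto
    let ?b = "\<lambda>n. norm (theta_term k a c n x) * norm (complex_of_real x powr (z - 1)) +
        norm (theta_term k a c n (1 / x)) * norm (complex_of_real x powr (- z - 1))"
    have "summable (\<lambda>n. ?b (int n) + ?b (-1 - int n))"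
      by (intro summable_add summable_mult2 th0 x)
    then show ?thesis
      by (rule summable_comparison_test'[where N = 0])
        (auto simp: u_def j_def norm_mult[symmetric] intro!: norm_triangle_mono)
  qed (simp add: u_def j_def)
  have "(\<lambda>n. integral\<^sup>L (lebesgue_on {0..1}) (u n)) sums (LINT x|lebesgue_on {0..1}. (\<Sum>n. u n x))"
    and ius: "integrable (lebesgue_on {0..1}) (\<lambda>x. \<Sum>n. u n x)"
  proof -
    have i: "integrable (lebesgue_on {0..1}) (u n)" for n using iu by (simp add: M)
    have ae: "AE x in lebesgue_on {0..1}. summable (\<lambda>n. norm (u n x))"
      by (rule AE_I2) (use su in auto)
    have sm: "summable (\<lambda>n. LINT x|lebesgue_on {0..1}. norm (u n x))"
      by (rule summable_comparison_test'[OF S1, of 0]) (use nu iu in \<open>auto simp: MR integral_nonneg absolutely_integrable_on_def\<close>)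
    show "(\<lambda>n. integral\<^sup>L (lebesgue_on {0..1}) (u n)) sums (LINT x|lebesgue_on {0..1}. (\<Sum>n. u n x))"
      by (rule sums_integral[OF i ae sm])
    show "integrable (lebesgue_on {0..1}) (\<lambda>x. \<Sum>n. u n x)"
      by (rule integrable_suminf[OF i ae sm])
  qed
  moreover have "integral\<^sup>L (lebesgue_on {0..1}) (u n) = integral {0..1} (u n)" for n
    using iu by (intro lebesgue_integral_eq_integral) (auto simp: M)
  moreover have "(LINT x|lebesgue_on {0..1}. (\<Sum>n. u n x)) = integral {0..1} (\<lambda>x. \<Sum>n. u n x)"
    using ius by (intro lebesgue_integral_eq_integral) auto
  ultimately have sums1: "(\<lambda>n. integral {0..1} (u n)) sums integral {0..1} (\<lambda>x. \<Sum>n. u n x)"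
    by simp
  have "integral {0..1} (\<lambda>x. \<Sum>n. u n x) =
     integral {0..1} (\<lambda>x. theta k a c x * of_real x powr (z - 1) + theta k a c (1 / x) * of_real x powr (- z - 1))"
  proof (rule integral_cong)
    fix x :: real assume x: "x \<in> {0..1}"
    show "(\<Sum>n. u n x) = theta k a c x * of_real x powr (z - 1) + theta k a c (1 / x) * of_real x powr (- z - 1)"
    proof (cases "x = 0")
      case False
      then have x: "x > 0" "1 / x > 0" using x by auto
      have "u n x = (theta_term k a c (int n) x + theta_term k a c (-1 - int n) x) * of_real x powr (z - 1) +
         (theta_term k a c (int n) (1 / x) + theta_term k a c (-1 - int n) (1 / x)) * of_real x powr (- z - 1)" for n
        by (simp add: u_def j_def algebra_simps)
      then show ?thesis
        by (simp only: theta_def suminf_mult2[OF th[OF x(1)]] suminf_mult2[OF th[OF x(2)]]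
            suminf_add[OF summable_mult2[OF th[OF x(1)]] summable_mult2[OF th[OF x(2)]]])
    qed (simp add: u_def j_def)
  qed
  moreover have "integral {0..1} (u n) = Gamma z * of_real pi powr (- z) *
      (cis (2 * pi * real n * a) * complex_of_real (real n + c) powr (- s) +
       (-1) ^ k * cis (- 2 * pi * a) * (cis (2 * pi * real n * (1 - a)) * complex_of_real (real n + (1 - c)) powr (- s)))" for n
  proof -
    have "integral {0..1} (u n) = integral {0..1} (j (int n)) + integral {0..1} (j (-1 - int n))"
      unfolding u_def using J(1) by (intro integral_add set_lebesgue_integral_eq_integral(1))
    also have "integral {0..1} (j (int n)) = Gamma z * of_real pi powr (- z) *
       (cis (2 * pi * real n * a) * complex_of_real (real n + c) powr (- s))"
      using power_mult_pi_square_powr[of "real n + c" k s] c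
      by (simp add: J(2) z_def mult_ac del: of_real_mult of_real_power of_real_add)
    \<comment> \<open>The index -1 - n yields the n-th term of the second Dirichlet series: its base
      is -(n + 1 - c), whose k-th power supplies (-1)^k, and its phase differs from that of the
      series by a full period.\<close>
    also have "integral {0..1} (j (-1 - int n)) = Gamma z * of_real pi powr (- z) *
       ((-1) ^ k * cis (- 2 * pi * a) * (cis (2 * pi * real n * (1 - a)) * complex_of_real (real n + (1 - c)) powr (- s)))"
    proof -
      have y: "of_int (-1 - int n) + c = - (real n + (1 - c))" by simp
      have "cis (- 2 * pi * a) * cis (2 * pi * real n * (1 - a)) = cis (2 * pi * of_int (-1 - int n) * a) * cis (2 * pi * real n)"
        unfolding cis_mult by (simp add: algebra_simps)
      also have "cis (2 * pi * real n) = 1" using cis_multiple_2pi[of "real n"] by simp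
      finally have e: "cis (2 * pi * of_int (-1 - int n) * a) = cis (- 2 * pi * a) * cis (2 * pi * real n * (1 - a))" by simp
      have m: "complex_of_real ((-1) ^ k * w) = (-1) ^ k * of_real w" for w by simp
      show ?thesis
        using power_mult_pi_square_powr[of "real n + (1 - c)" k s] c
        unfolding J(2) y e power_minus[of "real n + (1 - c)" k] power2_minus m
        by (simp add: z_def mult_ac del: of_real_mult of_real_power of_real_add)
    qed
    finally show ?thesis by (simp only: distrib_left)
  qed
  moreover have "(\<lambda>n. Gamma z * of_real pi powr (- z) *
      (cis (2 * pi * real n * a) * complex_of_real (real n + c) powr (- s) +
       (-1) ^ k * cis (- 2 * pi * a) * (cis (2 * pi * real n * (1 - a)) * complex_of_real (real n + (1 - c)) powr (- s))))
     sums (Gamma z * of_real pi powr (- z) *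
      (lerch_zeta_series s a c + (-1) ^ k * cis (- 2 * pi * a) * lerch_zeta_series s (1 - a) (1 - c)))"
    unfolding lerch_zeta_series_def
    using c s by (intro sums_mult sums_add summable_sums summable_lerch_zeta_series) auto
  ultimately show ?thesis using sums1 by (simp add: sums_unique2)
qed

section \<open>Incomplete gamma functions\<close>

lemma partial_fraction_dist_bound:
  fixes b :: "nat \<Rightarrow> complex"
  assumes "ball w (2 * d) \<subseteq> S" "z \<in> cball w d" "d > 0"
    and poles: "\<And>j z. z \<in> S \<Longrightarrow> b j \<noteq> 0 \<Longrightarrow> z + of_nat j \<noteq> 0"
  shows "norm (b j / (z + of_nat j)) \<le> norm (b j) / d"
proof (cases "b j = 0")
  case False
  have "norm (z + of_nat j) \<ge> d"
  proof (rule ccontr)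
    assume "\<not> norm (z + of_nat j) \<ge> d"
    then have "dist z (- of_nat j) < d" by (simp add: dist_norm)
    moreover have "dist w z \<le> d" using assms by simp
    ultimately have "dist w (- of_nat j) < 2 * d" using dist_triangle[of w "- of_nat j" z] by linarith
    then have "- of_nat j \<in> S" using assms(1) by auto
    then show False using poles[OF _ False, of "- of_nat j"] by simp
  qed
  then show ?thesis using assms(3) by (simp add: norm_divide frac_le)
qed simp

text \<open>Locally uniform convergence by the M-test, since a disc well inside \<open>S\<close>
  stays at distance d from the relevant poles. Poles are excluded only where \<open>b j\<close> is
  nonzero, so that a single pole can later be deleted by setting its coefficient to 0.\<close>

lemma
  fixes b :: "nat \<Rightarrow> complex"
  assumes S: "open S" and b: "summable (\<lambda>j. norm (b j))"
    and poles: "\<And>j z. z \<in> S \<Longrightarrow> b j \<noteq> 0 \<Longrightarrow> z + of_nat j \<noteq> 0"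
  shows holomorphic_partial_fraction_series: "(\<lambda>z. \<Sum>j. b j / (z + of_nat j)) holomorphic_on S"
    and summable_partial_fraction_series: "z \<in> S \<Longrightarrow> summable (\<lambda>j. b j / (z + of_nat j))"
proof -
  have ex: "\<exists>d>0. ball w (2 * d) \<subseteq> S" if w: "w \<in> S" for w
  proof -
    obtain e where "e > 0" "ball w e \<subseteq> S" using openE[OF S w] by metis
    then show ?thesis by (intro exI[of _ "e / 2"] conjI) simp_all
  qed
  show "(\<lambda>z. \<Sum>j. b j / (z + of_nat j)) holomorphic_on S"
  proof (rule holomorphic_uniform_sequence[OF S])
    show "(\<lambda>z. \<Sum>j<N. b j / (z + of_nat j)) holomorphic_on S" for N
    proof (rule holomorphic_on_sum)
      fix j show "(\<lambda>z. b j / (z + of_nat j)) holomorphic_on S"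
        using poles by (cases "b j = 0") (auto intro!: holomorphic_intros)
    qed
    fix w assume "w \<in> S"
    then obtain d where d: "d > 0" "ball w (2 * d) \<subseteq> S" using ex by blast
    have "uniform_limit (cball w d) (\<lambda>N z. \<Sum>j<N. b j / (z + of_nat j)) (\<lambda>z. \<Sum>j. b j / (z + of_nat j)) sequentially"
    proof (rule Weierstrass_m_test)
      show "norm (b j / (z + of_nat j)) \<le> norm (b j) / d" if "z \<in> cball w d" for j z
        by (rule partial_fraction_dist_bound[OF d(2) that d(1)]) (rule poles)
    qed (rule summable_divide[OF b])
    moreover have "cball w d \<subseteq> ball w (2 * d)" using d(1) by auto
    ultimately show "\<exists>d>0. cball w d \<subseteq> S \<and>
        uniform_limit (cball w d) (\<lambda>N z. \<Sum>j<N. b j / (z + of_nat j)) (\<lambda>z. \<Sum>j. b j / (z + of_nat j)) sequentially"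
      using d by blast
  qed
  show "summable (\<lambda>j. b j / (z + of_nat j))" if "z \<in> S"
  proof -
    obtain d where d: "d > 0" "ball z (2 * d) \<subseteq> S" using ex \<open>z \<in> S\<close> by blast
    have "norm (b j / (z + of_nat j)) \<le> norm (b j) / d" for j
      by (rule partial_fraction_dist_bound[OF d(2) _ d(1)]) (use d poles in auto)
    then show ?thesis
      by (rule summable_comparison_test'[OF summable_divide[OF b], of 0])
  qed
qed

text \<open>The classical lower incomplete gamma function divided by v^z, for v > 0. This
  normalization gives a power series in v that makes sense at v = 0, and the series form also
  supplies the continuation in z.\<close>

definition lower_gamma :: "complex \<Rightarrow> real \<Rightarrow> complex" where
  "lower_gamma z v = (\<Sum>j. of_real ((- v) ^ j / fact j) / (z + of_nat j))"

text \<open>For v > 0 the classical upper incomplete gamma function divided by v^z, after the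
  substitution t = 1 / x.\<close>

definition upper_gamma :: "complex \<Rightarrow> real \<Rightarrow> complex" where
  "upper_gamma z v = integral {0..1} (\<lambda>x. of_real (exp (- v / x)) * of_real x powr (- z - 1))"

lemma summable_norm_exp_coeff: "summable (\<lambda>j. norm (complex_of_real ((- v) ^ j / fact j)))"
  unfolding norm_of_real using summable_norm_exp[of "- v"] by (simp add: divide_inverse mult.commute)

lemma nonpos_Ints_complement_pole_free: "z \<in> - \<int>\<^sub>\<le>\<^sub>0 \<Longrightarrow> z + of_nat j \<noteq> (0::complex)"
  by (metis ComplD minus_of_nat_in_nonpos_Ints add_eq_0_iff2)

lemma holomorphic_lower_gamma: "(\<lambda>z. lower_gamma z v) holomorphic_on (- \<int>\<^sub>\<le>\<^sub>0)"
  unfolding lower_gamma_def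
  by (rule holomorphic_partial_fraction_series[OF _ summable_norm_exp_coeff nonpos_Ints_complement_pole_free]) auto

text \<open>The m-th partial fraction is isolated, and the rest of the series is holomorphic near
  -m. The numerator may vanish at -m, as it does for v = 0 and m > 0, so the pole can be
  absent.\<close>

lemma lower_gamma_simple_pole:
  obtains h where "h analytic_on {- of_nat m}"
    "\<And>z. z \<notin> \<int>\<^sub>\<le>\<^sub>0 \<Longrightarrow> lower_gamma z v = h z / (z + of_nat m)"
proof
  define b where "b j = complex_of_real ((- v) ^ j / fact j)" for j
  define b' where "b' = b(m := 0)"
  define S where "S = - (\<int>\<^sub>\<le>\<^sub>0 - {- of_nat m :: complex})"
  have sb: "summable (\<lambda>j. norm (b j))" unfolding b_def by (rule summable_norm_exp_coeff)
  have sb': "summable (\<lambda>j. norm (b' j))"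
    by (rule summable_comparison_test'[OF sb, of 0]) (auto simp: b'_def)
  have "closed (\<int>\<^sub>\<le>\<^sub>0 - {- of_nat m :: complex})"
    by (rule closed_subset_Ints) (auto simp: nonpos_Ints_def)
  then have S: "open S" unfolding S_def by (rule open_Compl)
  have poles: "z + of_nat j \<noteq> 0" if "z \<in> S" "b' j \<noteq> 0" for j z
  proof
    assume "z + of_nat j = 0"
    then have "z = - of_nat j" by (simp add: eq_neg_iff_add_eq_0)
    then show False using that by (auto simp: S_def b'_def split: if_splits)
  qed
  let ?h = "\<lambda>z. b m + (z + of_nat m) * (\<Sum>j. b' j / (z + of_nat j))"
  have "?h holomorphic_on S"
    by (intro holomorphic_intros holomorphic_partial_fraction_series[OF S sb' poles])
  then have "?h analytic_on S" using S by (simp add: analytic_on_open)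
  then show "?h analytic_on {- of_nat m}" by (rule analytic_on_subset) (auto simp: S_def)
  fix z :: complex assume z: "z \<notin> \<int>\<^sub>\<le>\<^sub>0"
  then have zm: "z + of_nat m \<noteq> 0" using nonpos_Ints_complement_pole_free by simp
  have "summable (\<lambda>j. b' j / (z + of_nat j))"
    by (rule summable_partial_fraction_series[OF S sb' poles]) (use z in \<open>auto simp: S_def\<close>)
  then have "(\<lambda>j. (if j = m then b j / (z + of_nat j) else 0) + b' j / (z + of_nat j)) sums
      (b m / (z + of_nat m) + (\<Sum>j. b' j / (z + of_nat j)))"
    by (intro sums_add sums_single summable_sums)
  moreover have "(if j = m then b j / (z + of_nat j) else 0) + b' j / (z + of_nat j) = b j / (z + of_nat j)" for j
    by (simp add: b'_def)
  ultimately have "lower_gamma z v = b m / (z + of_nat m) + (\<Sum>j. b' j / (z + of_nat j))"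
    by (simp add: lower_gamma_def b_def sums_iff)
  then show "lower_gamma z v = ?h z / (z + of_nat m)" using zm by (simp add: field_simps)
qed

lemma continuous_on_lower_gamma:
  assumes "z \<notin> \<int>\<^sub>\<le>\<^sub>0"
  shows "continuous_on {0..R} (lower_gamma z)"
proof -
  have "open (- \<int>\<^sub>\<le>\<^sub>0 :: complex set)" by auto
  then obtain e where e: "e > 0" "ball z e \<subseteq> - \<int>\<^sub>\<le>\<^sub>0"
    using assms by (metis ComplI openE)
  define d where "d = e / 2"
  have d: "d > 0" "ball z (2 * d) \<subseteq> - \<int>\<^sub>\<le>\<^sub>0" using e by (auto simp: d_def)
  show ?thesis
    unfolding lower_gamma_def
  proof (rule continuous_on_dominated_suminf)
    show "continuous_on {0..R} (\<lambda>v. of_real ((- v) ^ j / fact j) / (z + of_nat j))" for j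
      using nonpos_Ints_complement_pole_free[of z j] assms by (intro continuous_intros) auto
    show "summable (\<lambda>j. norm (complex_of_real ((- R) ^ j / fact j)) / d)"
      by (intro summable_divide summable_norm_exp_coeff)
    fix j v assume v: "v \<in> {0..R}"
    have "norm (of_real ((- v) ^ j / fact j) / (z + of_nat j)) \<le> norm (complex_of_real ((- v) ^ j / fact j)) / d"
      using partial_fraction_dist_bound[OF d(2) _ d(1), of z "\<lambda>j. of_real ((- v) ^ j / fact j)" j]
        nonpos_Ints_complement_pole_free d(1) by simp
    also have "\<dots> \<le> norm (complex_of_real ((- R) ^ j / fact j)) / d"
      using v d(1) by (auto simp: norm_divide norm_power intro!: divide_right_mono power_mono)
    finally show "norm (of_real ((- v) ^ j / fact j) / (z + of_nat j)) \<le> norm (complex_of_real ((- R) ^ j / fact j)) / d" .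
  qed
qed

lemma integral_of_real_powr:
  fixes w :: complex
  assumes w: "Re w > 1"
  shows "integral {0..1} (\<lambda>x. of_real x powr (w - 1)) = 1 / w"
proof -
  have w0: "w \<noteq> 0" using w by auto
  have "((\<lambda>x. of_real x powr (w - 1)) has_integral (of_real 1 powr w / w - of_real 0 powr w / w)) {0..1}"
  proof (rule fundamental_theorem_of_calculus_interior)
    show "continuous_on {0..1} (\<lambda>x. of_real x powr w / w)"
      using w w0 by (intro continuous_intros) auto
    fix x :: real assume x: "x \<in> {0<..<1}"
    have "((\<lambda>z. z powr w / w) has_field_derivative of_real x powr (w - 1)) (at (of_real x))"
      using x w0 by (auto intro!: derivative_eq_intros simp: complex_nonpos_Reals_iff)
    from has_vector_derivative_real_field[OF this]
    show "((\<lambda>x. of_real x powr w / w) has_vector_derivative of_real x powr (w - 1)) (at x)" by simp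
  qed simp
  then show ?thesis by (simp add: integral_unique)
qed

text \<open>Termwise integration of the exponential series. For Re z > 1 every term is continuous at
  0, so uniform convergence suffices; the half-plane is large enough for the later continuation in
  z.\<close>

lemma integral_eq_lower_gamma:
  assumes z: "Re z > 1"
  shows "integral {0..1} (\<lambda>x. of_real (exp (- v * x)) * of_real x powr (z - 1)) = lower_gamma z v"
proof -
  define u where "u j x = of_real ((- v) ^ j / fact j) * (of_real x powr (z + of_nat j - 1))" for j and x :: real
  have su: "(\<lambda>j. integral {0..1} (u j)) sums integral {0..1} (\<lambda>x. \<Sum>j. u j x)"
  proof (rule integral_dominated_suminf[OF _ _ summable_norm_exp_coeff])
    show "continuous_on {0..1} (u j)" for j
      unfolding u_def using z by (intro continuous_intros) auto
    show "norm (u j x) \<le> norm (complex_of_real ((- v) ^ j / fact j))" if "x \<in> {0..1}" for j x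
    proof -
      have "norm (of_real x powr (z + of_nat j - 1)) \<le> 1"
        using that z by (auto simp: norm_powr_real_powr intro!: powr_le1)
      then show ?thesis unfolding u_def norm_mult by (rule mult_left_le) auto
    qed
  qed
  have "integral {0..1} (u j) = of_real ((- v) ^ j / fact j) / (z + of_nat j)" for j
    unfolding u_def using integral_of_real_powr[of "z + of_nat j"] z by simp
  with su have "integral {0..1} (\<lambda>x. \<Sum>j. u j x) = lower_gamma z v"
    by (simp add: lower_gamma_def sums_iff)
  moreover have "(\<Sum>j. u j x) = of_real (exp (- v * x)) * of_real x powr (z - 1)" for x
  proof (cases "x = 0")
    case False
    have "u j x = of_real ((- v * x) ^ j /\<^sub>R fact j) * of_real x powr (z - 1)" for j
    proof -
      have "complex_of_real x powr (z + of_nat j - 1) = of_real x powr (z - 1) * of_real x powr of_nat j"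
        unfolding powr_add[symmetric] by (simp add: algebra_simps)
      then show ?thesis using False unfolding u_def power_mult_distrib by (simp add: field_simps)
    qed
    moreover have "(\<lambda>j. of_real ((- v * x) ^ j /\<^sub>R fact j) * of_real x powr (z - 1)) sums
       (complex_of_real (exp (- v * x)) * of_real x powr (z - 1))"
      by (intro sums_mult2 sums_of_real exp_converges)
    ultimately show ?thesis by (simp add: sums_iff)
  qed (simp add: u_def)
  ultimately show ?thesis by simp
qed

lemma holomorphic_upper_gamma:
  assumes "v > 0"
  shows "(\<lambda>z. upper_gamma z v) holomorphic_on UNIV"
    and "continuous_on {0..1} (\<lambda>x. of_real (exp (- v / x)) * complex_of_real x powr (- z - 1))"
proof -
  have c: "continuous_on {0<..1} (\<lambda>x. complex_of_real (exp (- v / x)))"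
    by (intro continuous_intros) auto
  have b: "norm (complex_of_real (exp (- v / x))) \<le> 1 * exp (- v / x)" for x by simp
  show "(\<lambda>z. upper_gamma z v) holomorphic_on UNIV"
    "continuous_on {0..1} (\<lambda>x. of_real (exp (- v / x)) * complex_of_real x powr (- z - 1))"
    unfolding upper_gamma_def
    by (rule holomorphic_kernel_integral[OF c b assms])+
qed

text \<open>The cut Euler integral proves this for Re z > 1, and the identity theorem carries it to
  every z where \<open>lower_gamma\<close> has no pole.\<close>

lemma Gamma_eq_lower_plus_upper:
  assumes v: "v > 0" and z: "z \<notin> \<int>\<^sub>\<le>\<^sub>0"
  shows "Gamma z * of_real v powr (- z) = lower_gamma z v + upper_gamma z v"
proof (rule analytic_continuation_open[where f = "\<lambda>z. Gamma z * of_real v powr (- z)"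
      and g = "\<lambda>z. lower_gamma z v + upper_gamma z v" and s = "{z. Re z > 1}" and s' = "- \<int>\<^sub>\<le>\<^sub>0"])
  show "open {z. Re z > 1}" by (rule open_halfspace_Re_gt)
  show "open (- \<int>\<^sub>\<le>\<^sub>0 :: complex set)" by auto
  show "{z. Re z > 1} \<noteq> {}" by (auto intro!: exI[of _ 2])
  \<comment> \<open>Deleting a countable set leaves the plane connected, as the identity theorem
    demands.\<close>
  have "countable (\<int>\<^sub>\<le>\<^sub>0 :: complex set)"
    by (rule countable_subset[of _ "\<int>"]) (auto simp: nonpos_Ints_def Ints_def)
  then show "connected (- \<int>\<^sub>\<le>\<^sub>0 :: complex set)"
    unfolding Compl_eq_Diff_UNIV by (intro connected_open_diff_countable) auto
  show "{z. Re z > 1} \<subseteq> - \<int>\<^sub>\<le>\<^sub>0" by (auto elim!: nonpos_Ints_cases)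
  show "(\<lambda>z. Gamma z * of_real v powr (- z)) holomorphic_on - \<int>\<^sub>\<le>\<^sub>0"
    using v by (intro holomorphic_intros) auto
  show "(\<lambda>z. lower_gamma z v + upper_gamma z v) holomorphic_on - \<int>\<^sub>\<le>\<^sub>0"
    by (intro holomorphic_intros holomorphic_lower_gamma holomorphic_on_subset[OF holomorphic_upper_gamma(1)[OF v]]) auto
  show "z \<in> - \<int>\<^sub>\<le>\<^sub>0" using z by simp
  fix z assume "z \<in> {z. Re z > 1}"
  then have "Re z > 1" by simp
  then show "Gamma z * of_real v powr (- z) = lower_gamma z v + upper_gamma z v"
    using gamma_mellin_split(3)[OF v, of z] unfolding upper_gamma_def integral_eq_lower_gamma[OF \<open>Re z > 1\<close>]
    by simp
qed

section \<open>The Lerch functions as theta integrals\<close>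

definition tail_integral :: "nat \<Rightarrow> real \<Rightarrow> real \<Rightarrow> complex \<Rightarrow> complex" where
  "tail_integral k a c z = integral {0..1} (\<lambda>x. theta_tail k a c (1 / x) * of_real x powr (- z - 1))"

text \<open>
  The summands \<open>n = 0\<close> and \<open>n = -1\<close>, the only ones for which \<open>n + c\<close> can vanish on the closed square.
\<close>

definition edge_terms :: "nat \<Rightarrow> real \<Rightarrow> real \<Rightarrow> (real \<Rightarrow> complex) \<Rightarrow> complex" where
  "edge_terms k a c f = of_real (c ^ k) * f (pi * c\<^sup>2) + cis (- 2 * pi * a) * of_real ((c - 1) ^ k) * f (pi * (c - 1)\<^sup>2)"

definition theta_integral :: "nat \<Rightarrow> real \<Rightarrow> real \<Rightarrow> complex \<Rightarrow> complex" where
  "theta_integral k a c z = tail_integral k a c z + edge_terms k a c (upper_gamma z)"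

text \<open>The minus sign is what remains when Gamma(z) v^(-z) is subtracted from
  \<open>upper_gamma z v\<close>.\<close>

definition renorm_integral :: "nat \<Rightarrow> real \<Rightarrow> real \<Rightarrow> complex \<Rightarrow> complex" where
  "renorm_integral k a c z = tail_integral k a c z - edge_terms k a c (lower_gamma z)"

lemma holomorphic_tail_integral:
  assumes k: "k \<in> {0, 1}" and ac: "a \<in> {0..1}" "c \<in> {0..1}"
  shows "tail_integral k a c holomorphic_on UNIV"
    and "continuous_on {0..1} (\<lambda>x. theta_tail k a c (1 / x) * of_real x powr (- z - 1))"
proof -
  obtain B where B: "\<And>k a c t. t \<ge> 1 \<Longrightarrow> k \<in> {0, 1} \<Longrightarrow> c \<in> {0..1} \<Longrightarrow> norm (theta_tail k a c t) \<le> B * exp (- pi * t)"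
    using norm_theta_tail_le by blast
  have b: "norm (theta_tail k a c (1 / x)) \<le> B * exp (- pi / x)" if "x \<in> {0<..1}" for x
    using B[of "1 / x" k c a] that k ac by simp
  have "continuous_on {0<..1} (\<lambda>x. case ((a, c), x) of (p, x) \<Rightarrow> theta_tail k (fst p) (snd p) (1 / x))"
    by (rule continuous_on_compose2[OF continuous_on_theta_tail[OF k]]) (use ac in \<open>auto intro!: continuous_intros\<close>)
  then have c: "continuous_on {0<..1} (\<lambda>x. theta_tail k a c (1 / x))" by simp
  show "tail_integral k a c holomorphic_on UNIV"
    using holomorphic_kernel_integral(1)[OF c b pi_gt_zero] by (simp add: tail_integral_def[abs_def])
  show "continuous_on {0..1} (\<lambda>x. theta_tail k a c (1 / x) * of_real x powr (- z - 1))"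
    by (rule holomorphic_kernel_integral(2)[OF c b pi_gt_zero])
qed

lemma continuous_on_tail_integral:
  assumes k: "k \<in> {0, 1}"
  shows "continuous_on ({0..1} \<times> {0..1}) (\<lambda>p. tail_integral k (fst p) (snd p) z)"
proof -
  obtain B where B: "\<And>k a c t. t \<ge> 1 \<Longrightarrow> k \<in> {0, 1} \<Longrightarrow> c \<in> {0..1} \<Longrightarrow> norm (theta_tail k a c t) \<le> B * exp (- pi * t)"
    using norm_theta_tail_le by blast
  have b: "norm (theta_tail k (fst p) (snd p) (1 / x)) \<le> B * exp (- pi / x)" if "p \<in> {0..1} \<times> {0..1}" "x \<in> {0<..1}" for p x
    using B[of "1 / x" k "snd p" "fst p"] that k by auto
  show ?thesis
    unfolding tail_integral_def
    by (rule continuous_on_kernel_integral[OF continuous_on_theta_tail[OF k] b pi_gt_zero])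
qed

lemma has_integral_theta_integral:
  assumes k: "k \<in> {0, 1}" and a: "a \<in> {0..1}" and c: "c \<in> {0<..<1}"
  shows "((\<lambda>x. theta k a c (1 / x) * of_real x powr (- z - 1)) has_integral theta_integral k a c z) {0..1}"
proof -
  have v: "pi * c\<^sup>2 > 0" "pi * (c - 1)\<^sup>2 > 0" using c by auto
  have ug: "((\<lambda>x. of_real (exp (- v / x)) * of_real x powr (- z - 1)) has_integral upper_gamma z v) {0..1}" if "v > 0" for v
    unfolding upper_gamma_def
    by (intro integrable_integral integrable_continuous_real holomorphic_upper_gamma(2)[OF that])
  have "((\<lambda>x. theta_tail k a c (1 / x) * of_real x powr (- z - 1) +
      (of_real (c ^ k) * (of_real (exp (- (pi * c\<^sup>2) / x)) * of_real x powr (- z - 1)) +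
       cis (- 2 * pi * a) * of_real ((c - 1) ^ k) * (of_real (exp (- (pi * (c - 1)\<^sup>2) / x)) * of_real x powr (- z - 1))))
     has_integral theta_integral k a c z) {0..1}"
    unfolding theta_integral_def edge_terms_def tail_integral_def
    using k a c v
    by (intro has_integral_add has_integral_mult_right ug integrable_integral integrable_continuous_real
        holomorphic_tail_integral) auto
  then show ?thesis
  proof (rule has_integral_eq[rotated])
    fix x :: real assume x: "x \<in> {0..1}"
    show "theta_tail k a c (1 / x) * of_real x powr (- z - 1) +
      (of_real (c ^ k) * (of_real (exp (- (pi * c\<^sup>2) / x)) * of_real x powr (- z - 1)) +
       cis (- 2 * pi * a) * of_real ((c - 1) ^ k) * (of_real (exp (- (pi * (c - 1)\<^sup>2) / x)) * of_real x powr (- z - 1))) =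
      theta k a c (1 / x) * of_real x powr (- z - 1)"
    proof (cases "x = 0")
      case False
      then have "1 / x > 0" using x by simp
      then have "theta k a c (1 / x) = theta_term k a c 0 (1 / x) + theta_term k a c (-1) (1 / x) + theta_tail k a c (1 / x)"
        by (rule theta_eq_tail) (use k c in auto)
      then show ?thesis by (simp add: theta_term_def algebra_simps)
    qed simp
  qed
qed

lemma holomorphic_theta_integral:
  assumes k: "k \<in> {0, 1}" and a: "a \<in> {0..1}" and c: "c \<in> {0<..<1}"
  shows "theta_integral k a c holomorphic_on UNIV"
  unfolding theta_integral_def[abs_def] edge_terms_def
  using assms by (intro holomorphic_intros holomorphic_tail_integral holomorphic_upper_gamma) auto

section \<open>Reflection symmetry (a, c) to (1 - a, 1 - c)\<close>

text \<open>Replacing n by -1 - n negates n + c after c -> 1 - c, which costs (-1)^k. The phases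
  match because cis (2 pi n) = 1.\<close>

lemma theta_term_reflect:
  "cis (- 2 * pi * a) * theta_term k (1 - a) (1 - c) n t = (-1) ^ k * theta_term k a c (-1 - n) t"
proof -
  have "cis (- 2 * pi * a) * cis (2 * pi * of_int n * (1 - a)) = cis (2 * pi * of_int (-1 - n) * a) * cis (2 * pi * of_int n)"
    unfolding cis_mult by (simp add: algebra_simps)
  also have "cis (2 * pi * of_int n) = 1" by (rule cis_multiple_2pi) auto
  finally have e: "cis (- 2 * pi * a) * cis (2 * pi * of_int n * (1 - a)) = cis (2 * pi * of_int (-1 - n) * a)" by simp
  have y: "of_int n + (1 - c) = - (of_int (-1 - n) + c)" by simp
  have m: "complex_of_real ((-1) ^ k * w) = (-1) ^ k * of_real w" for w by simp
  have "cis (- 2 * pi * a) * theta_term k (1 - a) (1 - c) n t =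
      cis (2 * pi * of_int (-1 - n) * a) * of_real ((of_int n + (1 - c)) ^ k * exp (- pi * (of_int n + (1 - c))\<^sup>2 * t))"
    unfolding theta_term_def e[symmetric] by (simp only: mult.assoc)
  also have "\<dots> = (-1) ^ k * theta_term k a c (-1 - n) t"
    unfolding theta_term_def y power2_minus power_minus[of "of_int (-1 - n) + c" k] mult.assoc m
    by (simp only: mult_ac)
  finally show ?thesis .
qed

lemma theta_tail_reflect:
  assumes "t > 0" "k \<in> {0, 1}" "c \<in> {0..1}"
  shows "cis (- 2 * pi * a) * theta_tail k (1 - a) (1 - c) t = (-1) ^ k * theta_tail k a c t"
proof -
  have S: "summable (\<lambda>n. theta_term k a c (int (Suc n)) t + theta_term k a c (-1 - int (Suc n)) t)"
    if "c \<in> {0..1}" for a c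
    using summable_theta[OF assms(1,2) that, of a]
      summable_Suc_iff[of "\<lambda>n. theta_term k a c (int n) t + theta_term k a c (-1 - int n) t"] by simp
  have c': "1 - c \<in> {0..1}" using assms by auto
  have "cis (- 2 * pi * a) * theta_tail k (1 - a) (1 - c) t =
    (\<Sum>n. cis (- 2 * pi * a) * (theta_term k (1 - a) (1 - c) (int (Suc n)) t + theta_term k (1 - a) (1 - c) (-1 - int (Suc n)) t))"
    unfolding theta_tail_def by (rule suminf_mult[OF S[OF c'], symmetric])
  also have "\<dots> = (\<Sum>n. (-1) ^ k * (theta_term k a c (int (Suc n)) t + theta_term k a c (-1 - int (Suc n)) t))"
  proof -
    have "cis (- 2 * pi * a) * (theta_term k (1 - a) (1 - c) (int (Suc n)) t + theta_term k (1 - a) (1 - c) (-1 - int (Suc n)) t) =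
      (-1) ^ k * (theta_term k a c (int (Suc n)) t + theta_term k a c (-1 - int (Suc n)) t)" for n
      unfolding distrib_left theta_term_reflect by simp
    then show ?thesis by simp
  qed
  also have "\<dots> = (-1) ^ k * theta_tail k a c t"
    unfolding theta_tail_def by (rule suminf_mult[OF S[OF assms(3)]])
  finally show ?thesis .
qed

text \<open>The reflection swaps the two edge terms; their phases agree up to the full period cis (-
  2 pi).\<close>

lemma edge_terms_reflect:
  "cis (- 2 * pi * a) * edge_terms k (1 - a) (1 - c) f = (-1) ^ k * edge_terms k a c f"
proof -
  have e: "cis (- 2 * pi * a) * cis (- 2 * pi * (1 - a)) = 1"
  proof -
    have "cis (- 2 * pi * a) * cis (- 2 * pi * (1 - a)) = cis (2 * pi * (-1))"
      unfolding cis_mult by (simp add: algebra_simps)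
    also have "\<dots> = 1" by (rule cis_multiple_2pi) auto
    finally show ?thesis .
  qed
  have m: "complex_of_real ((-1) ^ k * w) = (-1) ^ k * of_real w" for w by simp
  have p: "(1 - c) ^ k = (-1) ^ k * (c - 1) ^ k" "(1 - c - 1) ^ k = (-1) ^ k * c ^ k"
    using power_minus[of "c - 1" k] power_minus[of c k] by simp_all
  have q: "(1 - c)\<^sup>2 = (c - 1)\<^sup>2" "(1 - c - 1)\<^sup>2 = c\<^sup>2" by (simp_all add: power2_commute)
  have "cis (- 2 * pi * a) * edge_terms k (1 - a) (1 - c) f =
     (-1) ^ k * (cis (- 2 * pi * a) * of_real ((c - 1) ^ k) * f (pi * (c - 1)\<^sup>2)) +
     (cis (- 2 * pi * a) * cis (- 2 * pi * (1 - a))) * ((-1) ^ k * (of_real (c ^ k) * f (pi * c\<^sup>2)))"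
    unfolding edge_terms_def p q m by (simp only: distrib_left mult_ac)
  then show ?thesis unfolding e edge_terms_def by (simp add: algebra_simps)
qed

text \<open>Needed since two applications of (a, c) -> (1 - c, a) lead to (1 - a, 1 - c) instead of
  back to (a, c).\<close>

lemma renorm_integral_reflect:
  assumes "k \<in> {0, 1}" "c \<in> {0..1}"
  shows "cis (- 2 * pi * a) * renorm_integral k (1 - a) (1 - c) z = (-1) ^ k * renorm_integral k a c z"
proof -
  have "cis (- 2 * pi * a) * tail_integral k (1 - a) (1 - c) z =
      integral {0..1} (\<lambda>x. cis (- 2 * pi * a) * (theta_tail k (1 - a) (1 - c) (1 / x) * of_real x powr (- z - 1)))"
    by (simp add: tail_integral_def)
  also have "\<dots> = integral {0..1} (\<lambda>x. (-1) ^ k * (theta_tail k a c (1 / x) * of_real x powr (- z - 1)))"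
  proof (rule integral_cong)
    fix x :: real assume x: "x \<in> {0..1}"
    show "cis (- 2 * pi * a) * (theta_tail k (1 - a) (1 - c) (1 / x) * of_real x powr (- z - 1)) =
       (-1) ^ k * (theta_tail k a c (1 / x) * of_real x powr (- z - 1))"
    proof (cases "x = 0")
      case False
      then have "1 / x > 0" using x by simp
      from theta_tail_reflect[OF this assms] show ?thesis by (simp only: mult.assoc[symmetric])
    qed simp
  qed
  also have "\<dots> = (-1) ^ k * tail_integral k a c z" by (simp add: tail_integral_def)
  finally show ?thesis
    unfolding renorm_integral_def right_diff_distrib edge_terms_reflect by simp
qed

text \<open>This is the completed Lerch function on the open square; \<open>renorm_theta\<close> is
  its renormalized counterpart, meaningful up to the boundary.\<close>

definition lerch_theta :: "nat \<Rightarrow> complex \<Rightarrow> real \<Rightarrow> real \<Rightarrow> complex" where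
  "lerch_theta k s a c = theta_integral k a c ((s + of_nat k) / 2) +
     \<i> ^ k * cis (- 2 * pi * a * c) * theta_integral k (1 - c) a ((1 - s + of_nat k) / 2)"

definition renorm_theta :: "nat \<Rightarrow> complex \<Rightarrow> real \<Rightarrow> real \<Rightarrow> complex" where
  "renorm_theta k s a c = renorm_integral k a c ((s + of_nat k) / 2) +
     \<i> ^ k * cis (- 2 * pi * a * c) * renorm_integral k (1 - c) a ((1 - s + of_nat k) / 2)"

text \<open>The reciprocal of the completing factor. Written with \<open>rGamma\<close> it is
  visibly entire, so undoing the completion creates no poles.\<close>

definition gamma_factor_inv :: "nat \<Rightarrow> complex \<Rightarrow> complex" where
  "gamma_factor_inv k s = rGamma ((s + of_nat k) / 2) * of_real pi powr ((s + of_nat k) / 2)"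

text \<open>In the folded integral the part with theta at x <= 1 is rewritten by the transformation
  law, so that theta is evaluated only at 1 / x >= 1, where the integrals converge for every
  s.\<close>

lemma lerch_series_eq_lerch_theta:
  assumes k: "k \<in> {0, 1}" and a: "a \<in> {0<..<1}" and c: "c \<in> {0<..<1}" and s: "Re s > 1"
  shows "lerch_zeta_series s a c + (-1) ^ k * cis (- 2 * pi * a) * lerch_zeta_series s (1 - a) (1 - c) =
    gamma_factor_inv k s * lerch_theta k s a c"
proof -
  define z where "z = (s + of_nat k) / 2"
  define z' where "z' = (1 - s + of_nat k) / 2"
  let ?L = "lerch_zeta_series s a c + (-1) ^ k * cis (- 2 * pi * a) * lerch_zeta_series s (1 - a) (1 - c)"
  have "((\<lambda>x. \<i> ^ k * cis (- 2 * pi * a * c) * (theta k (1 - c) a (1 / x) * of_real x powr (- z' - 1)) +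
       theta k a c (1 / x) * of_real x powr (- z - 1)) has_integral
      \<i> ^ k * cis (- 2 * pi * a * c) * theta_integral k (1 - c) a z' + theta_integral k a c z) {0..1}"
    using k a c by (intro has_integral_add has_integral_mult_right has_integral_theta_integral) auto
  then have "((\<lambda>x. theta k a c x * of_real x powr (z - 1) + theta k a c (1 / x) * of_real x powr (- z - 1))
     has_integral (\<i> ^ k * cis (- 2 * pi * a * c) * theta_integral k (1 - c) a z' + theta_integral k a c z)) {0..1}"
  proof (rule has_integral_eq[rotated])
    fix x :: real assume x: "x \<in> {0..1}"
    show "\<i> ^ k * cis (- 2 * pi * a * c) * (theta k (1 - c) a (1 / x) * of_real x powr (- z' - 1)) +
       theta k a c (1 / x) * of_real x powr (- z - 1) =
      theta k a c x * of_real x powr (z - 1) + theta k a c (1 / x) * of_real x powr (- z - 1)"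
    proof (cases "x = 0")
      case False
      then have x0: "x > 0" using x by simp
      have "complex_of_real (x powr (- 1 / 2 - real k)) * of_real x powr (z - 1) =
          of_real x powr of_real (- 1 / 2 - real k) * of_real x powr (z - 1)"
        using x0 powr_of_real[of x "- 1 / 2 - real k"] by simp
      also have "\<dots> = of_real x powr (of_real (- 1 / 2 - real k) + (z - 1))"
        by (rule powr_add[symmetric])
      \<comment> \<open>Since z + z' = 1 / 2 + k, the power of t in the transformation law is
        exactly the one that exchanges the two Mellin exponents.\<close>
      also have "of_real (- 1 / 2 - real k) + (z - 1) = - z' - 1"
        by (simp add: z_def z'_def add_divide_distrib diff_divide_distrib)
      finally have p: "complex_of_real (x powr (- 1 / 2 - real k)) * of_real x powr (z - 1) = of_real x powr (- z' - 1)" .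
      have "theta k a c x = \<i> ^ k * cis (- 2 * pi * a * c) * of_real (x powr (- 1 / 2 - real k)) * theta k (1 - c) a (1 / x)"
        by (rule theta_transformation[OF x0 k]) (use a c in auto)
      then show ?thesis unfolding p[symmetric] by (simp only: mult_ac)
    qed simp
  qed
  then have LT: "lerch_theta k s a c = Gamma z * of_real pi powr (- z) * ?L"
    using lerch_series_eq_theta_integral[OF k c s z_def, of a]
    by (simp add: lerch_theta_def z_def z'_def integral_unique)
  have "gamma_factor_inv k s * lerch_theta k s a c =
      (rGamma z * Gamma z) * (of_real pi powr z * of_real pi powr (- z)) * ?L"
    unfolding LT gamma_factor_inv_def z_def[symmetric] by (simp only: mult_ac)
  moreover have "rGamma z * Gamma z = 1"
  proof -
    have "Re z > 0" using s by (simp add: z_def)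
    then have "z \<notin> \<int>\<^sub>\<le>\<^sub>0" by (auto elim!: nonpos_Ints_cases)
    then show ?thesis by (simp add: rGamma_inverse_Gamma Gamma_eq_zero_iff)
  qed
  moreover have "complex_of_real pi powr z * of_real pi powr (- z) = 1"
    unfolding powr_add[symmetric] by simp
  ultimately show ?thesis by simp
qed

text \<open>The right-hand side is entire and agrees with the series for Re s > 1. It thus shows
  that the definite description in \<open>lerch_L\<close> denotes something, and the identity
  theorem gives its uniqueness.\<close>

lemma lerch_L_eq:
  assumes k: "k \<in> {0, 1}" and a: "a \<in> {0<..<1}" and c: "c \<in> {0<..<1}"
  shows "lerch_L k s a c = gamma_factor_inv k s * lerch_theta k s a c"
proof -
  define f where "f s = gamma_factor_inv k s * lerch_theta k s a c" for s
  have h1: "(\<lambda>s. theta_integral k a c ((s + of_nat k) / 2)) holomorphic_on UNIV"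
    by (rule holomorphic_on_compose_gen[OF _ holomorphic_theta_integral[OF k _ c], unfolded o_def])
      (use a in \<open>auto intro!: holomorphic_intros\<close>)
  have c': "1 - c \<in> {0..1}" using c by auto
  have h2: "(\<lambda>s. theta_integral k (1 - c) a ((1 - s + of_nat k) / 2)) holomorphic_on UNIV"
    by (rule holomorphic_on_compose_gen[OF _ holomorphic_theta_integral[OF k c' a], unfolded o_def])
      (auto intro!: holomorphic_intros)
  have f: "f holomorphic_on UNIV"
    unfolding f_def lerch_theta_def gamma_factor_inv_def by (intro holomorphic_intros h1 h2) auto
  have "(THE f. f holomorphic_on UNIV \<and> (\<forall>z. Re z > 1 \<longrightarrow>
           f z = lerch_zeta_series z a c
                 + (-1) ^ k * cis (- 2 * pi * a) * lerch_zeta_series z (1 - a) (1 - c))) = f"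
  proof (rule the_equality)
    show "f holomorphic_on UNIV \<and> (\<forall>z. Re z > 1 \<longrightarrow>
           f z = lerch_zeta_series z a c
                 + (-1) ^ k * cis (- 2 * pi * a) * lerch_zeta_series z (1 - a) (1 - c))"
      using f lerch_series_eq_lerch_theta[OF k a c] by (simp add: f_def)
    fix g assume g: "g holomorphic_on UNIV \<and> (\<forall>z. Re z > 1 \<longrightarrow>
           g z = lerch_zeta_series z a c
                 + (-1) ^ k * cis (- 2 * pi * a) * lerch_zeta_series z (1 - a) (1 - c))"
    show "g = f"
    proof
      fix w
      show "g w = f w"
      proof (rule analytic_continuation_open[where f = g and g = f and s = "{z. Re z > 1}" and s' = UNIV])
        show "open {z. Re z > 1}" by (rule open_halfspace_Re_gt)
        show "{z. Re z > 1} \<noteq> {}" by (auto intro!: exI[of _ 2])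
        show "g z = f z" if "z \<in> {z. Re z > 1}" for z
          using g that lerch_series_eq_lerch_theta[OF k a c, of z] by (simp add: f_def)
      qed (use f g in auto)
    qed
  qed
  then show ?thesis by (simp add: lerch_L_def f_def)
qed

section \<open>The renormalized functions\<close>

lemma half_shift_not_nonpos_Ints:
  fixes s :: complex
  assumes "s \<notin> \<int>"
  shows "(s + of_nat k) / 2 \<notin> \<int>\<^sub>\<le>\<^sub>0" "(1 - s + of_nat k) / 2 \<notin> \<int>\<^sub>\<le>\<^sub>0"
proof -
  have "s = 2 * ((s + of_nat k) / 2) - of_nat k" by (simp add: field_simps)
  then show "(s + of_nat k) / 2 \<notin> \<int>\<^sub>\<le>\<^sub>0"
    using assms nonpos_Ints_subset_Ints by (metis Ints_diff Ints_mult Ints_numeral Ints_of_nat subsetD)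
  have "s = 1 + of_nat k - 2 * ((1 - s + of_nat k) / 2)" by (simp add: field_simps)
  then show "(1 - s + of_nat k) / 2 \<notin> \<int>\<^sub>\<le>\<^sub>0"
    using assms nonpos_Ints_subset_Ints
    by (metis Ints_1 Ints_add Ints_diff Ints_mult Ints_numeral Ints_of_nat subsetD)
qed

text \<open>Edge terms with the full Mellin transform reproduce, up to the completing factor, the
  first brace of \<open>lerch_S\<close>; applied at (1 - c, a) and 1 - s they give the
  second.\<close>

lemma edge_terms_Gamma:
  assumes c: "c \<in> {0<..<1}" and z: "z = (s + of_nat k) / 2"
  shows "edge_terms k a c (\<lambda>v. Gamma z * of_real v powr (- z)) =
    Gamma z * of_real pi powr (- z) *
      (of_real c powr (- s) + (-1) ^ k * cis (- 2 * pi * a) * of_real (1 - c) powr (- s))"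
proof -
  have m: "complex_of_real ((c - 1) ^ k) = (-1) ^ k * of_real ((1 - c) ^ k)"
    using power_minus[of "1 - c" k] by simp
  have q: "(c - 1)\<^sup>2 = (1 - c)\<^sup>2" by (rule power2_commute)
  have 1: "of_real (c ^ k) * of_real (pi * c\<^sup>2) powr (- z) = complex_of_real pi powr (- z) * of_real c powr (- s)"
    "of_real ((1 - c) ^ k) * of_real (pi * (1 - c)\<^sup>2) powr (- z) = complex_of_real pi powr (- z) * of_real (1 - c) powr (- s)"
    using power_mult_pi_square_powr[of c k s] power_mult_pi_square_powr[of "1 - c" k s] c unfolding z by simp_all
  have "edge_terms k a c (\<lambda>v. Gamma z * of_real v powr (- z)) =
    Gamma z * (of_real (c ^ k) * of_real (pi * c\<^sup>2) powr (- z)) +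
    (-1) ^ k * cis (- 2 * pi * a) * Gamma z * (of_real ((1 - c) ^ k) * of_real (pi * (1 - c)\<^sup>2) powr (- z))"
    unfolding edge_terms_def m q by (simp only: mult_ac)
  then show ?thesis unfolding 1 by (simp only: distrib_left mult_ac)
qed

lemma theta_integral_minus_edge_terms_Gamma:
  assumes "c \<in> {0<..<1}" "z \<notin> \<int>\<^sub>\<le>\<^sub>0"
  shows "theta_integral k a c z - edge_terms k a c (\<lambda>v. Gamma z * of_real v powr (- z)) = renorm_integral k a c z"
proof -
  have v: "pi * c\<^sup>2 > 0" "pi * (c - 1)\<^sup>2 > 0" using assms by auto
  show ?thesis
    unfolding theta_integral_def renorm_integral_def edge_terms_def
      Gamma_eq_lower_plus_upper[OF v(1) assms(2)] Gamma_eq_lower_plus_upper[OF v(2) assms(2)]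
    by (simp add: algebra_simps)
qed

lemma gamma_factor_inv_mult:
  assumes "(s + of_nat k) / 2 \<notin> \<int>\<^sub>\<le>\<^sub>0"
  shows "gamma_factor_inv k s * (Gamma ((s + of_nat k) / 2) * of_real pi powr (- ((s + of_nat k) / 2))) = 1"
proof -
  let ?z = "(s + of_nat k) / 2"
  have "rGamma ?z * Gamma ?z = 1" using assms by (simp add: rGamma_inverse_Gamma Gamma_eq_zero_iff)
  moreover have "complex_of_real pi powr ?z * of_real pi powr (- ?z) = 1"
    unfolding powr_add[symmetric] by simp
  moreover have "gamma_factor_inv k s * (Gamma ?z * of_real pi powr (- ?z)) =
     (rGamma ?z * Gamma ?z) * (complex_of_real pi powr ?z * of_real pi powr (- ?z))"
    unfolding gamma_factor_inv_def by (simp only: mult_ac)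
  ultimately show ?thesis by simp
qed

text \<open>The Tate gamma function at 1 - s is the completing factor at 1 - s over the one at s. It
  therefore converts the mirrored edge terms to the normalization of the direct ones.\<close>

lemma tate_gamma_eq:
  assumes k: "k \<in> {0, 1}"
  shows "tate_gamma k (1 - s) = gamma_factor_inv k s *
    (Gamma ((1 - s + of_nat k) / 2) * of_real pi powr (- ((1 - s + of_nat k) / 2)))"
proof -
  define z where "z = (s + of_nat k) / 2"
  define z' where "z' = (1 - s + of_nat k) / 2"
  have "tate_gamma k (1 - s) = (of_real pi powr (- z') * Gamma z') / (of_real pi powr (- z) * Gamma z)"
  proof (cases "k = 0")
    case True
    have "1 - (1 - s) = s" by simp
    then show ?thesis
      unfolding tate_gamma_def tate_gamma_plus_def z_def z'_def minus_divide_left[symmetric] by (simp add: True)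
  next
    case False
    then have k1: "k = 1" using k by simp
    have "2 - (1 - s) = s + 1" by simp
    then show ?thesis
      unfolding tate_gamma_def tate_gamma_minus_def z_def z'_def minus_divide_left[symmetric] by (simp add: k1 add.commute)
  qed
  also have "\<dots> = (inverse (Gamma z) * inverse (of_real pi powr (- z))) * (Gamma z' * of_real pi powr (- z'))"
    by (simp only: divide_inverse inverse_mult_distrib mult_ac)
  also have "inverse (of_real pi powr (- z)) = complex_of_real pi powr z"
    unfolding powr_minus inverse_inverse_eq ..
  finally show ?thesis
    unfolding gamma_factor_inv_def rGamma_inverse_Gamma z_def z'_def .
qed

text \<open>Both \<open>lerch_L\<close> and \<open>lerch_S\<close> are
  \<open>gamma_factor_inv\<close> times an expression of the same shape, with \<open>X\<close> and
  \<open>Y\<close> as the full edge terms at (a, c) and (1 - c, a). Subtracting them separately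
  inside the two theta integrals renormalizes each one.\<close>

lemma lerch_LR_interior_eq:
  assumes k: "k \<in> {0, 1}" and a: "a \<in> {0<..<1}" and c: "c \<in> {0<..<1}" and s: "s \<notin> \<int>"
  shows "lerch_LR_interior k s (a, c) = gamma_factor_inv k s * renorm_theta k s a c"
proof -
  define z where "z = (s + of_nat k) / 2"
  define z' where "z' = (1 - s + of_nat k) / 2"
  define g where "g = gamma_factor_inv k s"
  define e where "e = cis (- 2 * pi * a * c)"
  define P where "P = of_real c powr (- s) + (-1) ^ k * cis (- 2 * pi * a) * complex_of_real (1 - c) powr (- s)"
  define Q where "Q = of_real a powr (s - 1) + (-1) ^ k * cis (- 2 * pi * (1 - c)) * complex_of_real (1 - a) powr (s - 1)"
  define X where "X = edge_terms k a c (\<lambda>v. Gamma z * of_real v powr (- z))"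
  define Y where "Y = edge_terms k (1 - c) a (\<lambda>v. Gamma z' * of_real v powr (- z'))"
  have zz: "z \<notin> \<int>\<^sub>\<le>\<^sub>0" "z' \<notin> \<int>\<^sub>\<le>\<^sub>0"
    using half_shift_not_nonpos_Ints[OF s] by (auto simp: z_def z'_def)
  have X: "X = Gamma z * of_real pi powr (- z) * P"
    unfolding X_def P_def by (rule edge_terms_Gamma[OF c z_def])
  have Y: "Y = Gamma z' * of_real pi powr (- z') * Q"
    unfolding Y_def Q_def using edge_terms_Gamma[OF a z'_def, of "1 - c"] by simp
  \<comment> \<open>Brings the last phase of \<open>lerch_S\<close> into the form that the edge
    terms at (1 - c, a) carry, up to a full period.\<close>
  have ec: "cis (2 * pi * (1 - a) * c) = e * cis (- 2 * pi * (1 - c))"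
  proof -
    have "e * cis (- 2 * pi * (1 - c)) = cis (2 * pi * (1 - a) * c) * cis (2 * pi * (-1))"
      unfolding e_def cis_mult by (simp add: algebra_simps)
    also have "cis (2 * pi * (-1)) = 1" by (rule cis_multiple_2pi) auto
    finally show ?thesis by simp
  qed
  have gP: "g * X = P"
    using gamma_factor_inv_mult[of s k] zz(1) unfolding X g_def z_def by (simp add: mult.assoc[symmetric])
  have t: "tate_gamma k (1 - s) = g * (Gamma z' * of_real pi powr (- z'))"
    unfolding g_def z'_def by (rule tate_gamma_eq[OF k])
  have "lerch_S k s a c = P + \<i> ^ k * (g * (Gamma z' * of_real pi powr (- z'))) * (e * Q)"
    unfolding lerch_S_def t ec P_def Q_def e_def[symmetric] by (simp add: algebra_simps)
  then have S: "lerch_S k s a c = g * (X + \<i> ^ k * e * Y)"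
    unfolding gP[symmetric] Y by (simp add: algebra_simps)
  have "lerch_LR_interior k s (a, c) = g * (theta_integral k a c z + \<i> ^ k * e * theta_integral k (1 - c) a z') - g * (X + \<i> ^ k * e * Y)"
    unfolding lerch_LR_interior_def prod.case S lerch_L_eq[OF k a c] lerch_theta_def g_def z_def z'_def e_def ..
  also have "\<dots> = g * ((theta_integral k a c z - X) + \<i> ^ k * e * (theta_integral k (1 - c) a z' - Y))"
    by (simp add: algebra_simps)
  also have "theta_integral k a c z - X = renorm_integral k a c z"
    unfolding X_def by (rule theta_integral_minus_edge_terms_Gamma[OF c zz(1)])
  also have "theta_integral k (1 - c) a z' - Y = renorm_integral k (1 - c) a z'"
    unfolding Y_def by (rule theta_integral_minus_edge_terms_Gamma[OF a zz(2)])
  finally show ?thesis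
    unfolding g_def renorm_theta_def z_def z'_def e_def .
qed

lemma continuous_on_renorm_integral:
  assumes k: "k \<in> {0, 1}" and z: "z \<notin> \<int>\<^sub>\<le>\<^sub>0"
  shows "continuous_on ({0..1} \<times> {0..1}) (\<lambda>p. renorm_integral k (fst p) (snd p) z)"
proof -
  \<comment> \<open>Both c and c - 1 lie in [-1, 1], so \<open>lower_gamma\<close> is only evaluated
    on [0, pi].\<close>
  have sq: "pi * y\<^sup>2 \<in> {0..pi}" if "y \<in> {-1..1}" for y :: real
  proof -
    have "y\<^sup>2 \<le> 1" using that by (simp add: abs_square_le_1 abs_le_iff)
    then show ?thesis by (simp add: mult_left_le)
  qed
  show ?thesis
    unfolding renorm_integral_def edge_terms_def
    by (intro continuous_intros continuous_on_tail_integral[OF k]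
        continuous_on_compose2[OF continuous_on_lower_gamma[OF z, of pi]] image_subsetI sq) auto
qed

lemma continuous_on_renorm_theta:
  assumes k: "k \<in> {0, 1}" and s: "s \<notin> \<int>"
  shows "continuous_on closed_square (\<lambda>p. renorm_theta k s (fst p) (snd p))"
proof -
  note z = half_shift_not_nonpos_Ints[OF s]
  have "continuous_on ({0..1} \<times> {0..1}) (\<lambda>p. renorm_integral k (fst (1 - snd p, fst p)) (snd (1 - snd p, fst p)) ((1 - s + of_nat k) / 2))"
    by (rule continuous_on_compose2[OF continuous_on_renorm_integral[OF k z(2)]])
      (auto intro!: continuous_intros)
  then show ?thesis
    unfolding closed_square_def renorm_theta_def
    by (intro continuous_intros continuous_on_renorm_integral[OF k z(1)]) simp_all
qed

lemma is_continuous_extension_renorm_theta: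
  assumes k: "k \<in> {0, 1}" and s: "s \<notin> \<int>"
  shows "is_continuous_extension (lerch_LR_interior k s)
    (\<lambda>p. gamma_factor_inv k s * renorm_theta k s (fst p) (snd p))"
  unfolding is_continuous_extension_def
  using continuous_on_renorm_theta[OF assms] lerch_LR_interior_eq[OF k _ _ s]
  by (auto simp: open_square_def intro!: continuous_intros)

lemma closure_open_square: "closure open_square = closed_square"
  by (simp add: open_square_def closed_square_def closure_Times)

lemma is_continuous_extension_unique:
  assumes "is_continuous_extension f g" "is_continuous_extension f h" "p \<in> closed_square"
  shows "g p = h p"
proof -
  have "g p - h p = 0"
    by (rule continuous_constant_on_closure[of open_square "\<lambda>p. g p - h p"])
      (use assms in \<open>auto simp: is_continuous_extension_def closure_open_square intro!: continuous_intros\<close>)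
  then show ?thesis by simp
qed

text \<open>The explicit formula is one continuous extension, and density of the open square forces
  the chosen one to agree with it.\<close>

lemma lerch_LR_eq:
  assumes k: "k \<in> {0, 1}" and s: "s \<notin> \<int>" and ac: "(a, c) \<in> closed_square"
  shows "lerch_LR k s a c = gamma_factor_inv k s * renorm_theta k s a c"
proof -
  note E = is_continuous_extension_renorm_theta[OF k s]
  have "is_continuous_extension (lerch_LR_interior k s) (SOME g. is_continuous_extension (lerch_LR_interior k s) g)"
    by (rule someI[of "is_continuous_extension (lerch_LR_interior k s)", OF E])
  from is_continuous_extension_unique[OF this E ac] show ?thesis by (simp add: lerch_LR_def)
qed

text \<open>The substitution exchanges the two summands, except that the first one returns at (1 -
  a, 1 - c). Reflection brings it back: its sign (-1)^k cancels i^k i^k, and the two phases multiply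
  to the factor cis (- 2 pi a) that the reflection absorbs.\<close>

lemma renorm_theta_functional_equation:
  assumes k: "k \<in> {0, 1}" and ac: "(a, c) \<in> closed_square"
  shows "renorm_theta k s a c = \<i> ^ k * cis (- 2 * pi * a * c) * renorm_theta k (1 - s) (1 - c) a"
proof -
  define A where "A = renorm_integral k a c ((s + of_nat k) / 2)"
  define A' where "A' = renorm_integral k (1 - a) (1 - c) ((s + of_nat k) / 2)"
  define B where "B = renorm_integral k (1 - c) a ((1 - s + of_nat k) / 2)"
  have r: "cis (- 2 * pi * a) * A' = (-1) ^ k * A"
    unfolding A_def A'_def by (rule renorm_integral_reflect[OF k]) (use ac in \<open>auto simp: closed_square_def\<close>)
  have e: "cis (- 2 * pi * a * c) * cis (- 2 * pi * (1 - c) * a) = cis (- 2 * pi * a)"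
    unfolding cis_mult by (simp add: algebra_simps)
  have i: "\<i> ^ k * \<i> ^ k = (-1 :: complex) ^ k" "(-1 :: complex) ^ k * (-1) ^ k = 1"
    unfolding power_mult_distrib[symmetric] by simp_all
  have "\<i> ^ k * cis (- 2 * pi * a * c) * renorm_theta k (1 - s) (1 - c) a =
    \<i> ^ k * cis (- 2 * pi * a * c) * (B + \<i> ^ k * cis (- 2 * pi * (1 - c) * a) * A')"
    unfolding renorm_theta_def A'_def B_def by simp
  also have "\<dots> = \<i> ^ k * cis (- 2 * pi * a * c) * B +
     (\<i> ^ k * \<i> ^ k) * ((cis (- 2 * pi * a * c) * cis (- 2 * pi * (1 - c) * a)) * A')"
    by (simp only: distrib_left mult_ac)
  also have "\<dots> = \<i> ^ k * cis (- 2 * pi * a * c) * B + ((-1) ^ k * (-1) ^ k) * A"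
    unfolding i(1) e r by (simp only: mult_ac)
  also have "\<dots> = renorm_theta k s a c"
    unfolding i(2) renorm_theta_def A_def B_def by simp
  finally show ?thesis ..
qed

lemma completed_lerch_LR_eq:
  assumes k: "k \<in> {0, 1}" and s: "s \<notin> \<int>" and ac: "(a, c) \<in> closed_square"
  shows "completed_lerch_LR k s a c = renorm_theta k s a c"
proof -
  let ?z = "(s + of_nat k) / 2"
  have "completed_lerch_LR k s a c =
     (gamma_factor_inv k s * (Gamma ?z * of_real pi powr (- ?z))) * renorm_theta k s a c"
    unfolding completed_lerch_LR_def lerch_LR_eq[OF assms] minus_divide_left[symmetric] by (simp only: mult_ac)
  then show ?thesis
    using gamma_factor_inv_mult[OF half_shift_not_nonpos_Ints(1)[OF s], of k] by simp
qed

section \<open>Simple poles in s\<close>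

text \<open>Regular points are included and the value at \<open>w\<close> itself is ignored. The
  notion is thus stable under sums, where poles may cancel, and insensitive to the arbitrary values
  of \<open>lerch_LR\<close> at integers.\<close>

definition at_most_simple_pole :: "(complex \<Rightarrow> complex) \<Rightarrow> complex \<Rightarrow> bool" where
  "at_most_simple_pole f w \<longleftrightarrow> (\<exists>h. h analytic_on {w} \<and> (\<forall>\<^sub>F z in at w. f z = h z / (z - w)))"

lemma at_most_simple_pole_analytic:
  assumes "f analytic_on {w}"
  shows "at_most_simple_pole f w"
  unfolding at_most_simple_pole_def
proof (intro exI conjI)
  show "(\<lambda>z. f z * (z - w)) analytic_on {w}" by (intro analytic_intros assms)
  show "\<forall>\<^sub>F z in at w. f z = f z * (z - w) / (z - w)"
    by (auto simp: eventually_at_filter)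
qed

lemma at_most_simple_pole_add:
  assumes "at_most_simple_pole f w" "at_most_simple_pole g w"
  shows "at_most_simple_pole (\<lambda>z. f z + g z) w"
proof -
  obtain h1 where h1: "h1 analytic_on {w}" "\<forall>\<^sub>F z in at w. f z = h1 z / (z - w)"
    using assms(1) by (auto simp: at_most_simple_pole_def)
  obtain h2 where h2: "h2 analytic_on {w}" "\<forall>\<^sub>F z in at w. g z = h2 z / (z - w)"
    using assms(2) by (auto simp: at_most_simple_pole_def)
  have "\<forall>\<^sub>F z in at w. f z + g z = (h1 z + h2 z) / (z - w)"
    using h1(2) h2(2) by eventually_elim (simp add: add_divide_distrib)
  then show ?thesis
    unfolding at_most_simple_pole_def using h1(1) h2(1) by (blast intro: analytic_on_add)
qed

lemma at_most_simple_pole_mult: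
  assumes "g analytic_on {w}" "at_most_simple_pole f w"
  shows "at_most_simple_pole (\<lambda>z. g z * f z) w"
proof -
  obtain h where h: "h analytic_on {w}" "\<forall>\<^sub>F z in at w. f z = h z / (z - w)"
    using assms(2) by (auto simp: at_most_simple_pole_def)
  have "\<forall>\<^sub>F z in at w. g z * f z = (g z * h z) / (z - w)"
    using h(2) by eventually_elim simp
  then show ?thesis
    unfolding at_most_simple_pole_def using h(1) assms(1) by (blast intro: analytic_on_mult)
qed

lemma at_most_simple_pole_diff:
  assumes "at_most_simple_pole f w" "at_most_simple_pole g w"
  shows "at_most_simple_pole (\<lambda>z. f z - g z) w"
  using at_most_simple_pole_add[OF assms(1) at_most_simple_pole_mult[OF _ assms(2), of "\<lambda>_. -1"]] by simp

lemma at_most_simple_pole_cong: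
  assumes "\<forall>\<^sub>F z in at w. f z = g z" "at_most_simple_pole g w"
  shows "at_most_simple_pole f w"
proof -
  obtain h where h: "h analytic_on {w}" "\<forall>\<^sub>F z in at w. g z = h z / (z - w)"
    using assms(2) by (auto simp: at_most_simple_pole_def)
  have "\<forall>\<^sub>F z in at w. f z = h z / (z - w)"
    using h(2) assms(1) by eventually_elim simp
  then show ?thesis unfolding at_most_simple_pole_def using h(1) by blast
qed

lemma meromorphic_at_most_simple_pole:
  assumes "at_most_simple_pole f w"
  shows "f meromorphic_on {w}"
proof -
  obtain h where h: "h analytic_on {w}" "\<forall>\<^sub>F z in at w. f z = h z / (z - w)"
    using assms by (auto simp: at_most_simple_pole_def)
  have "(\<lambda>z. h z / (z - w)) meromorphic_on {w}"
    by (intro meromorphic_intros analytic_on_imp_meromorphic_on[OF h(1)])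
  then show ?thesis using meromorphic_on_cong[of "{w}" f "\<lambda>z. h z / (z - w)" "{w}"] h(2) by simp
qed

text \<open>If the numerator vanished at \<open>w\<close>, the quotient would tend to its derivative
  there, which contradicts the pole.\<close>

lemma zorder_at_most_simple_pole:
  assumes "at_most_simple_pole f w" "is_pole f w"
  shows "zorder f w = -1"
proof -
  obtain h where h: "h analytic_on {w}" "\<forall>\<^sub>F z in at w. f z = h z / (z - w)"
    using assms by (auto simp: at_most_simple_pole_def)
  have "h w \<noteq> 0"
  proof
    assume h0: "h w = 0"
    obtain D where "(h has_field_derivative D) (at w)"
      using analytic_on_imp_differentiable_at[OF h(1)] by (auto simp: field_differentiable_def)
    then have "((\<lambda>z. h z / (z - w)) \<longlongrightarrow> D) (at w)"
      using h0 by (simp add: has_field_derivative_iff)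
    moreover have "filterlim (\<lambda>z. h z / (z - w)) at_infinity (at w)"
      using is_pole_transform[OF assms(2) h(2) refl] by (simp add: is_pole_def)
    ultimately show False using not_tendsto_and_filterlim_at_infinity[of "at w"] by auto
  qed
  obtain S where S: "open S" "w \<in> S" "h holomorphic_on S"
    using h(1) by (auto simp: analytic_at)
  obtain T where T: "open T" "w \<in> T" "\<And>z. z \<in> T \<Longrightarrow> z \<noteq> w \<Longrightarrow> f z = h z / (z - w)"
    using h(2) by (auto simp: eventually_at_topological)
  show ?thesis
    by (rule zorder_eqI[of "S \<inter> T" w h])
      (use S T \<open>h w \<noteq> 0\<close> in \<open>auto intro: holomorphic_on_subset simp: power_int_minus divide_inverse\<close>)
qed

text \<open>Lets formulas proved only for non-integer s decide the behaviour at integers.\<close>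

lemma eventually_not_Ints_at: "\<forall>\<^sub>F z in at w. z \<notin> (\<int> :: complex set)"
proof -
  have "open (- (\<int> - {w}))" by (intro open_Compl closed_subset_Ints) auto
  moreover have "w \<in> - (\<int> - {w})" by simp
  ultimately show ?thesis
    unfolding eventually_at_topological by (metis ComplD DiffI singletonD)
qed

text \<open>The affine substitution has nonzero slope, so it preserves the order of a pole. It is
  needed for slope 1 / 2 in the direct part and -1 / 2 in the mirrored part.\<close>

lemma at_most_simple_pole_lower_gamma:
  fixes \<alpha> \<beta> w :: complex
  assumes \<alpha>: "\<alpha> \<noteq> 0" and nonint: "\<And>s. s \<notin> \<int> \<Longrightarrow> \<alpha> * s + \<beta> \<notin> \<int>\<^sub>\<le>\<^sub>0"
  shows "at_most_simple_pole (\<lambda>s. lower_gamma (\<alpha> * s + \<beta>) v) w"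
proof (cases "\<alpha> * w + \<beta> \<in> \<int>\<^sub>\<le>\<^sub>0")
  case False
  have "(\<lambda>z. lower_gamma z v) analytic_on (- \<int>\<^sub>\<le>\<^sub>0)"
    using holomorphic_lower_gamma by (subst analytic_on_open) auto
  then have "(\<lambda>z. lower_gamma z v) analytic_on (\<lambda>s. \<alpha> * s + \<beta>) ` {w}"
    by (rule analytic_on_subset) (use False in auto)
  then have "((\<lambda>z. lower_gamma z v) \<circ> (\<lambda>s. \<alpha> * s + \<beta>)) analytic_on {w}"
    by (intro analytic_on_compose analytic_intros) auto
  then show ?thesis by (intro at_most_simple_pole_analytic) (simp add: o_def)
next
  case True
  then obtain m where m: "\<alpha> * w + \<beta> = - of_nat m" by (auto elim: nonpos_Ints_cases')
  obtain h where h: "h analytic_on {- of_nat m}"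
    "\<And>z. z \<notin> \<int>\<^sub>\<le>\<^sub>0 \<Longrightarrow> lower_gamma z v = h z / (z + of_nat m)"
    using lower_gamma_simple_pole by blast
  have "h analytic_on (\<lambda>s. \<alpha> * s + \<beta>) ` {w}" using h(1) m by simp
  then have "(h \<circ> (\<lambda>s. \<alpha> * s + \<beta>)) analytic_on {w}"
    by (intro analytic_on_compose analytic_intros) auto
  then have "(\<lambda>s. h (\<alpha> * s + \<beta>) / \<alpha>) analytic_on {w}"
    using \<alpha> by (intro analytic_intros) (auto simp: o_def)
  moreover have "\<forall>\<^sub>F s in at w. lower_gamma (\<alpha> * s + \<beta>) v = h (\<alpha> * s + \<beta>) / \<alpha> / (s - w)"
    using eventually_not_Ints_at
  proof eventually_elim
    case (elim s)
    have "\<alpha> * s + \<beta> + of_nat m = \<alpha> * (s - w)" using m by (simp add: algebra_simps eq_neg_iff_add_eq_0)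
    then show ?case using h(2)[OF nonint[OF elim]] by simp
  qed
  ultimately show ?thesis unfolding at_most_simple_pole_def by blast
qed

lemma at_most_simple_pole_renorm_integral:
  fixes \<alpha> \<beta> w :: complex
  assumes "k \<in> {0, 1}" "a \<in> {0..1}" "c \<in> {0..1}"
    and \<alpha>: "\<alpha> \<noteq> 0" "\<And>s. s \<notin> \<int> \<Longrightarrow> \<alpha> * s + \<beta> \<notin> \<int>\<^sub>\<le>\<^sub>0"
  shows "at_most_simple_pole (\<lambda>s. renorm_integral k a c (\<alpha> * s + \<beta>)) w"
proof -
  have "tail_integral k a c analytic_on UNIV"
    using holomorphic_tail_integral(1)[OF assms(1-3)] by (simp add: analytic_on_open)
  then have "(tail_integral k a c \<circ> (\<lambda>s. \<alpha> * s + \<beta>)) analytic_on {w}"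
    by (intro analytic_on_compose analytic_intros) (auto intro: analytic_on_subset)
  then have "at_most_simple_pole (\<lambda>s. tail_integral k a c (\<alpha> * s + \<beta>)) w"
    by (intro at_most_simple_pole_analytic) (simp add: o_def)
  then show ?thesis
    unfolding renorm_integral_def edge_terms_def
    by (intro at_most_simple_pole_diff at_most_simple_pole_add at_most_simple_pole_mult
        at_most_simple_pole_lower_gamma \<alpha> analytic_on_const)
qed

lemma holomorphic_renorm_integral:
  assumes "k \<in> {0, 1}" "a \<in> {0..1}" "c \<in> {0..1}"
  shows "renorm_integral k a c holomorphic_on (- \<int>\<^sub>\<le>\<^sub>0)"
  unfolding renorm_integral_def[abs_def] edge_terms_def
  by (intro holomorphic_intros holomorphic_lower_gamma
      holomorphic_on_subset[OF holomorphic_tail_integral(1)[OF assms]]) auto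

lemma holomorphic_gamma_factor_inv: "gamma_factor_inv k holomorphic_on A"
  unfolding gamma_factor_inv_def[abs_def] by (intro holomorphic_intros) auto

lemma analytic_lerch_LR:
  assumes k: "k \<in> {0, 1}" and ac: "(a, c) \<in> closed_square"
  shows "(\<lambda>s. lerch_LR k s a c) analytic_on (- \<int>)"
proof -
  have op: "open (- \<int> :: complex set)" by (intro open_Compl closed_subset_Ints) auto
  have R: "a \<in> {0..1}" "c \<in> {0..1}" "1 - c \<in> {0..1}" using ac by (auto simp: closed_square_def)
  have h1: "(\<lambda>s. renorm_integral k a c ((s + of_nat k) / 2)) holomorphic_on - \<int>"
    by (rule holomorphic_on_compose_gen[OF _ holomorphic_renorm_integral[OF k R(1,2)], unfolded o_def])
      (use half_shift_not_nonpos_Ints in \<open>auto intro!: holomorphic_intros\<close>)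
  have h2: "(\<lambda>s. renorm_integral k (1 - c) a ((1 - s + of_nat k) / 2)) holomorphic_on - \<int>"
    by (rule holomorphic_on_compose_gen[OF _ holomorphic_renorm_integral[OF k R(3,1)], unfolded o_def])
      (use half_shift_not_nonpos_Ints in \<open>auto intro!: holomorphic_intros\<close>)
  have "(\<lambda>s. gamma_factor_inv k s * renorm_theta k s a c) holomorphic_on - \<int>"
    unfolding renorm_theta_def by (intro holomorphic_intros holomorphic_gamma_factor_inv h1 h2)
  then have "(\<lambda>s. lerch_LR k s a c) holomorphic_on - \<int>"
    by (rule holomorphic_transform) (use lerch_LR_eq[OF k _ ac] in auto)
  then show ?thesis using op by (simp add: analytic_on_open)
qed

lemma at_most_simple_pole_lerch_LR:
  assumes k: "k \<in> {0, 1}" and ac: "(a, c) \<in> closed_square"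
  shows "at_most_simple_pole (\<lambda>s. lerch_LR k s a c) w"
proof (rule at_most_simple_pole_cong)
  show "\<forall>\<^sub>F s in at w. lerch_LR k s a c = gamma_factor_inv k s * renorm_theta k s a c"
    using eventually_not_Ints_at by eventually_elim (rule lerch_LR_eq[OF k _ ac])
  have R: "a \<in> {0..1}" "c \<in> {0..1}" "1 - c \<in> {0..1}" using ac by (auto simp: closed_square_def)
  \<comment> \<open>In the affine form the candidate poles are visible: s = -k - 2 j from the direct
    part and s = 1 + k + 2 j from the mirrored part, for natural j.\<close>
  have e1: "(s + of_nat k) / 2 = (1 / 2) * s + of_nat k / 2" for s :: complex by (simp add: field_simps)
  have e2: "(1 - s + of_nat k) / 2 = (- 1 / 2) * s + (1 + of_nat k) / 2" for s :: complex by (simp add: field_simps)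
  have p1: "at_most_simple_pole (\<lambda>s. renorm_integral k a c ((s + of_nat k) / 2)) w"
    unfolding e1 by (rule at_most_simple_pole_renorm_integral[OF k R(1,2)])
      (use half_shift_not_nonpos_Ints(1)[of _ k, unfolded e1] in auto)
  have p2: "at_most_simple_pole (\<lambda>s. renorm_integral k (1 - c) a ((1 - s + of_nat k) / 2)) w"
    unfolding e2 by (rule at_most_simple_pole_renorm_integral[OF k R(3,1)])
      (use half_shift_not_nonpos_Ints(2)[of _ k, unfolded e2] in auto)
  have g: "gamma_factor_inv k analytic_on {w}"
    using holomorphic_gamma_factor_inv[of k UNIV] by (auto simp: analytic_at)
  show "at_most_simple_pole (\<lambda>s. gamma_factor_inv k s * renorm_theta k s a c) w"
    unfolding renorm_theta_def
    by (intro at_most_simple_pole_mult at_most_simple_pole_add p1 p2 g analytic_on_const)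
qed

theorem theorem7p3:
  fixes k :: nat
  assumes "k \<in> {0, 1}"
  shows "(\<forall>s. s \<notin> \<int> \<longrightarrow> (\<exists>g. is_continuous_extension (lerch_LR_interior k s) g)) \<and>
    (\<forall>a c. (a, c) \<in> closed_square \<longrightarrow>
       (\<lambda>s. lerch_LR k s a c) meromorphic_on UNIV \<and>
       (\<lambda>s. lerch_LR k s a c) analytic_on (- \<int>) \<and>
       (\<forall>z. is_pole (\<lambda>s. lerch_LR k s a c) z \<longrightarrow>
          z \<in> \<int> \<and> zorder (\<lambda>s. lerch_LR k s a c) z = -1)) \<and>
    (\<forall>s a c. s \<notin> \<int> \<and> (a, c) \<in> closed_square \<longrightarrow>
       completed_lerch_LR k s a c =
         root_number k * cis (- 2 * pi * a * c) * completed_lerch_LR k (1 - s) (1 - c) a)"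
proof (intro conjI allI impI)
  fix s :: complex assume "s \<notin> \<int>"
  then show "\<exists>g. is_continuous_extension (lerch_LR_interior k s) g"
    using is_continuous_extension_renorm_theta[OF assms] by blast
next
  fix a c :: real assume ac: "(a, c) \<in> closed_square"
  note sp = at_most_simple_pole_lerch_LR[OF assms ac] and an = analytic_lerch_LR[OF assms ac]
  show "(\<lambda>s. lerch_LR k s a c) meromorphic_on UNIV"
    using meromorphic_at_most_simple_pole[OF sp] by (subst meromorphic_on_meromorphic_at) blast
  show "(\<lambda>s. lerch_LR k s a c) analytic_on (- \<int>)" by (rule an)
  fix z assume pole: "is_pole (\<lambda>s. lerch_LR k s a c) z"
  show "z \<in> \<int>"
    using pole analytic_at_imp_no_pole analytic_on_subset[OF an, of "{z}"] by blast
  show "zorder (\<lambda>s. lerch_LR k s a c) z = -1"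
    by (rule zorder_at_most_simple_pole[OF sp pole])
next
  fix s :: complex and a c :: real assume *: "s \<notin> \<int> \<and> (a, c) \<in> closed_square"
  then have s': "1 - s \<notin> \<int>" using Ints_diff[of 1 "1 - s"] by auto
  have ac': "(1 - c, a) \<in> closed_square" using * by (auto simp: closed_square_def)
  have "root_number k = \<i> ^ k" using assms by (auto simp: root_number_def)
  then show "completed_lerch_LR k s a c =
      root_number k * cis (- 2 * pi * a * c) * completed_lerch_LR k (1 - s) (1 - c) a"
    using renorm_theta_functional_equation[OF assms, of a c s] *
    by (simp add: completed_lerch_LR_eq[OF assms] s' ac')
qed

end
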